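(* Let $L$ be a finite set of integers, each at least $2$, with largest element $k$. Then, as $n\to\infty$, \[\vec{c}(L,n)=\left(\frac{n-1}{k-1}\right)^{k-1}+O(n^{k-2}),\] where the implied constant depends only on $L$.
   Context: Directed graphs are finite with no loops and no multiple arcs (two opposite arcs $uv$ and $vu$ are allowed). A directed graph is an $L$-cycle digraph if the length of every directed cycle in it belongs to $L$. $\vec{c}(L,n)$ denotes the maximum number of directed cycles in an $n$-vertex $L$-cycle digraph. *)

theory Defs
  imports "Graph_Theory.Pair_Digraph" "HOL-Library.Landau_Symbols"
begin

text \<open>
  A directed cycle of \<open>G\<close> is a subgraph, identified here with its set of arcs. The predicate
  \<^const>\<open>pre_digraph.cycle\<close> speaks about arc lists, so a directed cycle of length \<open>l\<close> is traced
  by \<open>l\<close> such lists (its rotations), all of which have the same arc set.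
\<close>

definition directed_cycles :: "'a pair_pre_digraph \<Rightarrow> ('a \<times> 'a) set set" where
  "directed_cycles G = {set p |p. pre_digraph.cycle (with_proj G) p}"

definition L_cycle_digraph :: "nat set \<Rightarrow> 'a pair_pre_digraph \<Rightarrow> bool" where
  "L_cycle_digraph L G \<longleftrightarrow>
     pair_digraph G \<and> (\<forall>p. pre_digraph.cycle (with_proj G) p \<longrightarrow> length p \<in> L)"

text \<open>
  Every finite digraph is isomorphic to one whose vertices are natural numbers, so it suffices to
  maximise over those.
\<close>

definition max_cycles :: "nat set \<Rightarrow> nat \<Rightarrow> nat" where
  "max_cycles L n =
     Max {card (directed_cycles G) |G :: nat pair_pre_digraph.
            L_cycle_digraph L G \<and> card (pverts G) = n}"

lemma card_set_cycle:
  assumes "pair_digraph G" "pre_digraph.cycle (with_proj G) p"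
  shows "card (set p) = length p"
proof -
  interpret pair_digraph G by fact
  show ?thesis
    using assms(2) by (auto simp: cycle_conv distinct_card)
qed

lemma directed_cycles_subset: "directed_cycles G \<subseteq> Pow (parcs G)"
  by (auto simp: directed_cycles_def pre_digraph.cycle_def pre_digraph.awalk_def)

text \<open>\<^const>\<open>Max\<close> is unspecified on empty and on infinite sets; neither occurs in \<^const>\<open>max_cycles\<close>.\<close>

lemma finite_cycle_counts:
  "finite {card (directed_cycles G) |G :: nat pair_pre_digraph.
            L_cycle_digraph L G \<and> card (pverts G) = n}"
proof (rule finite_subset)
  show "{card (directed_cycles G) |G :: nat pair_pre_digraph.
          L_cycle_digraph L G \<and> card (pverts G) = n} \<subseteq> {..2 ^ (n * n)}"
  proof clarsimp
    fix G :: "nat pair_pre_digraph"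
    assume G: "L_cycle_digraph L G" and n: "n = card (pverts G)"
    interpret pair_digraph G using G by (simp add: L_cycle_digraph_def)
    have "card (directed_cycles G) \<le> card (Pow (parcs G))"
      by (intro card_mono directed_cycles_subset) (simp add: pair_finite_arcs)
    also have "\<dots> = 2 ^ card (parcs G)"
      by (simp add: card_Pow pair_finite_arcs)
    also have "card (parcs G) \<le> card (pverts G \<times> pverts G)"
      by (intro card_mono) (auto simp: pair_finite_verts dest: in_arcsD1 in_arcsD2)
    then have "(2::nat) ^ card (parcs G) \<le> 2 ^ (card (pverts G) * card (pverts G))"
      by (simp add: card_cartesian_product)
    finally show "card (directed_cycles G) \<le> 2 ^ (card (pverts G) * card (pverts G))" .
  qed
qed simp

lemma cycle_counts_nonempty:
  "{card (directed_cycles G) |G :: nat pair_pre_digraph.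
      L_cycle_digraph L G \<and> card (pverts G) = n} \<noteq> {}"
proof -
  let ?G = "\<lparr>pverts = {..<n}, parcs = {}\<rparr>"
  have "pair_digraph ?G" by unfold_locales auto
  then have "L_cycle_digraph L ?G"
    by (auto simp: L_cycle_digraph_def pre_digraph.cycle_def pre_digraph.awalk_def)
  then show ?thesis
    by (auto intro!: exI[of _ ?G])
qed

end

theory Submission
  imports Defs "HOL-Analysis.Convex"
begin

text \<open>
  Lower bound: a hub followed by \<open>k - 1\<close> layers of almost equal size, where every layer is joined
  completely to the next one and the last layer to the hub.

  Upper bound: the arcs leaving the end of a longest path return to its last \<open>k\<close> vertices, so
  the end lies in \<open>O(n ^ (l - 2))\<close> cycles of length \<open>l\<close>, and deleting it repeatedly leaves only the
  cycles of length \<open>k\<close> to be counted. For these, vertices in fewer than \<open>c * n ^ (k - 2)\<close>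
  cycles can be deleted one by one. If there are none, let \<open>Q @ v # \<dots>\<close> be a longest path, with \<open>k - 1\<close>
  vertices following the hub \<open>v\<close>. Except for \<open>O(n ^ (k - 3))\<close> of them, the cycles through its end contain
  \<open>v\<close> and avoid \<open>Q\<close>; rerouting the path shows the same for every vertex of the set \<open>W\<close> of all
  vertices lying on many cycles through \<open>v\<close> that avoid \<open>Q\<close>. Such a vertex has only one possible distance from
  \<open>v\<close>, since otherwise two cycles could be spliced into one longer than \<open>k\<close>. So \<open>W\<close> splits into
  \<open>k - 1\<close> layers, and by the inequality of the means at most
  \<open>(card W / (k - 1)) ^ (k - 1) + O(n ^ (k - 2))\<close> cycles meet \<open>W\<close>. The cycles through the end of the path already show that
  \<open>W\<close> has linear size, so deleting it and applying induction gives the bound with an error of order \<open>n ^ (k - 2)\<close>.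
\<close>

subsection \<open>Paths and cycles as vertex lists\<close>

definition dpath :: "'a rel \<Rightarrow> 'a list \<Rightarrow> bool" where
  "dpath E xs \<longleftrightarrow> distinct xs \<and> successively (\<lambda>x y. (x, y) \<in> E) xs"

text \<open>\<open>rotate1\<close> also pairs the last entry with the first, which supplies the
  closing arc. The list under \<open>set\<close> is the arc walk of
  \<open>cycle_iff_dcycle\<close>.\<close>

definition arcset :: "'a list \<Rightarrow> 'a rel" where
  "arcset xs = set (zip xs (rotate1 xs))"

definition dcycle :: "'a rel \<Rightarrow> 'a list \<Rightarrow> bool" where
  "dcycle E xs \<longleftrightarrow> xs \<noteq> [] \<and> distinct xs \<and> arcset xs \<subseteq> E"

text \<open>Taking arc sets counts all rotations of a list as one cycle; a proof can then pick the
  rotation that suits it (\<open>cycles_obtain_nth\<close>).\<close>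

definition cycles :: "'a rel \<Rightarrow> nat \<Rightarrow> 'a rel set" where
  "cycles E l = arcset ` {xs. dcycle E xs \<and> length xs = l}"

lemma dpath_Nil [simp]: "dpath E []"
  by (simp add: dpath_def)

lemma dpath_single [simp]: "dpath E [x]"
  by (simp add: dpath_def)

lemma dpath_append:
  "dpath E (xs @ ys) \<longleftrightarrow> dpath E xs \<and> dpath E ys \<and> set xs \<inter> set ys = {} \<and>
     (xs = [] \<or> ys = [] \<or> (last xs, hd ys) \<in> E)"
  by (auto simp: dpath_def successively_append_iff)

lemma dpath_Cons:
  "dpath E (x # ys) \<longleftrightarrow> dpath E ys \<and> x \<notin> set ys \<and> (ys = [] \<or> (x, hd ys) \<in> E)"
  by (auto simp: dpath_def successively_Cons)

lemma arcset_subset_iff: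
  assumes "xs \<noteq> []"
  shows "arcset xs \<subseteq> E \<longleftrightarrow> successively (\<lambda>x y. (x, y) \<in> E) xs \<and> (last xs, hd xs) \<in> E"
proof -
  \<comment> \<open>The closing vertex \<open>z\<close> is separated from the first vertex
    \<open>x\<close>, since the induction changes \<open>x\<close> only.\<close>
  have *: "set (zip (x # ys) (ys @ [z])) \<subseteq> E \<longleftrightarrow>
      successively (\<lambda>x y. (x, y) \<in> E) (x # ys) \<and> (last (x # ys), z) \<in> E" for x z :: 'a and ys
    by (induction ys arbitrary: x) auto
  show ?thesis
    using assms *[of "hd xs" "tl xs" "hd xs"] by (cases xs) (simp_all add: arcset_def)
qed

lemma dcycle_iff: "dcycle E xs \<longleftrightarrow> xs \<noteq> [] \<and> dpath E xs \<and> (last xs, hd xs) \<in> E"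
  using arcset_subset_iff[of xs E] by (auto simp: dcycle_def dpath_def)

lemma Domain_arcset: "Domain (arcset xs) = set xs"
proof -
  have "Domain (arcset xs) = set (map fst (zip xs (rotate1 xs)))"
    by (simp add: arcset_def Domain_fst del: map_fst_zip)
  also have "map fst (zip xs (rotate1 xs)) = xs" by (rule map_fst_zip) simp
  finally show ?thesis .
qed

lemma arcset_rotate: "arcset (rotate n xs) = arcset xs"
proof -
  have zip: "length xs = length ys \<Longrightarrow> zip (rotate1 xs) (rotate1 ys) = rotate1 (zip xs ys)"
    for xs ys :: "'a list"
    by (cases xs; cases ys) auto
  have *: "arcset (rotate1 ys) = arcset ys" for ys :: "'a list"
    unfolding arcset_def by (simp add: zip)
  show ?thesis by (induction n) (simp_all add: *)
qed

lemma dcycle_rotate: "dcycle E (rotate n xs) \<longleftrightarrow> dcycle E xs"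
  by (simp add: dcycle_def arcset_rotate)

lemma cycles_obtain_nth:
  assumes "c \<in> cycles E l" and "u \<in> Domain c" and "i < l"
  obtains xs where "dcycle E xs" "length xs = l" "c = arcset xs" "xs ! i = u"
proof -
  obtain ys where ys: "dcycle E ys" "length ys = l" "c = arcset ys"
    using assms(1) by (auto simp: cycles_def)
  then obtain j where j: "j < l" "ys ! j = u"
    using assms(2) by (auto simp: Domain_arcset in_set_conv_nth)
  \<comment> \<open>Positions count modulo \<open>l\<close>; the summand \<open>l\<close> keeps the
    subtraction from truncating.\<close>
  have "rotate (l + j - i) ys ! i = u"
    using j ys assms(3) by (simp add: nth_rotate)
  then show ?thesis
    using that[of "rotate (l + j - i) ys"] ys by (simp add: dcycle_rotate arcset_rotate)
qed

lemma dcycle_mono: "dcycle E xs \<Longrightarrow> E \<subseteq> F \<Longrightarrow> dcycle F xs"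
  by (auto simp: dcycle_def)

lemma dcycle_subset: "dcycle E xs \<Longrightarrow> E \<subseteq> V \<times> V \<Longrightarrow> set xs \<subseteq> V"
  using Domain_arcset[of xs] by (fastforce simp: dcycle_def)

lemma finite_dcycles:
  assumes "finite V" "E \<subseteq> V \<times> V"
  shows "finite {xs. dcycle E xs \<and> length xs = l \<and> P xs}"
  by (rule finite_subset[OF _ finite_lists_length_eq[OF assms(1), of l]])
     (use dcycle_subset[OF _ assms(2)] in blast)

lemma finite_cycles:
  assumes "finite V" "E \<subseteq> V \<times> V"
  shows "finite (cycles E l)"
  using finite_dcycles[OF assms, of l "\<lambda>_. True"] by (simp add: cycles_def)

text \<open>Every vertex of a cycle is the tail of one of its arcs, so \<open>Domain c\<close> is
  the vertex set of \<open>c\<close>. This is the bookkeeping for deletions of vertices.\<close>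

lemma cycles_restrict:
  assumes "E \<subseteq> V \<times> V"
  shows "cycles E l = cycles (E \<inter> (V - A) \<times> (V - A)) l \<union> {c \<in> cycles E l. Domain c \<inter> A \<noteq> {}}"
proof -
  have "arcset xs \<subseteq> (V - A) \<times> (V - A)"
    if "dcycle E xs" "set xs \<inter> A = {}" for xs
  proof -
    have "set (rotate1 xs) \<subseteq> V - A" "set xs \<subseteq> V - A"
      using that dcycle_subset[OF that(1) assms] by auto
    then show ?thesis
      unfolding arcset_def by (meson set_zip_leftD set_zip_rightD subrelI subsetD SigmaI)
  qed
  then show ?thesis
    by (fastforce simp: cycles_def dcycle_def Domain_arcset)
qed

subsection \<open>Counting lists with prescribed entries\<close>

lemma card_UN_bound:
  assumes "finite I" "\<And>i. i \<in> I \<Longrightarrow> card (S i) \<le> N"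
  shows "card (\<Union>i\<in>I. S i) \<le> card I * N"
proof -
  have "card (\<Union>i\<in>I. S i) \<le> (\<Sum>i\<in>I. card (S i))" by (rule card_UN_le[OF assms(1)])
  also have "\<dots> \<le> card I * N" using sum_bounded_above[of I "\<lambda>i. card (S i)" N] assms by simp
  finally show ?thesis .
qed

text \<open>A relaxation for counting: cycles are replaced by arbitrary lists, in which every
  position outside \<open>I\<close> is free and worth a factor \<open>card V\<close>.\<close>

definition fixed_lists :: "'a set \<Rightarrow> nat \<Rightarrow> nat set \<Rightarrow> (nat \<Rightarrow> 'a) \<Rightarrow> 'a list set" where
  "fixed_lists V m I f = {xs. length xs = m \<and> set xs \<subseteq> V \<and> (\<forall>i\<in>I. xs ! i = f i)}"

lemma finite_fixed_lists: "finite V \<Longrightarrow> finite (fixed_lists V m I f)"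
  by (rule finite_subset[OF _ finite_lists_length_eq[of V m]]) (auto simp: fixed_lists_def)

lemma card_fixed_lists:
  assumes "finite V" "I \<subseteq> {..<m}"
  shows "card (fixed_lists V m I f) \<le> card V ^ (m - card I)"
proof -
  let ?J = "{..<m} - I"
  have "card (fixed_lists V m I f) \<le> card (PiE ?J (\<lambda>_. V))"
  proof (rule card_inj_on_le)
    show "inj_on (\<lambda>xs. restrict (nth xs) ?J) (fixed_lists V m I f)"
    proof (rule inj_onI)
      fix xs ys
      assume *: "xs \<in> fixed_lists V m I f" "ys \<in> fixed_lists V m I f"
        "restrict (nth xs) ?J = restrict (nth ys) ?J"
      show "xs = ys"
      proof (rule nth_equalityI)
        show "length xs = length ys" using * by (simp add: fixed_lists_def)
        fix i assume "i < length xs"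
        then show "xs ! i = ys ! i"
          using *(1,2) fun_cong[OF *(3), of i] by (cases "i \<in> I") (simp_all add: fixed_lists_def)
      qed
    qed
    show "(\<lambda>xs. restrict (nth xs) ?J) ` fixed_lists V m I f \<subseteq> PiE ?J (\<lambda>_. V)"
      unfolding fixed_lists_def by (intro image_subsetI restrict_PiE_iff[THEN iffD2] ballI) auto
    show "finite (PiE ?J (\<lambda>_. V))" using assms by (intro finite_PiE) auto
  qed
  also have "\<dots> = card V ^ (m - card I)"
    using assms(2) by (simp add: card_PiE card_Diff_subset finite_subset)
  finally show ?thesis .
qed

text \<open>Guessing the position and the value of the entry in \<open>B\<close> fixes one more
  position, which saves a factor \<open>card V\<close> when \<open>B\<close> has bounded
  size.\<close>

lemma card_fixed_lists_hit:
  assumes "finite V" "finite B" "I \<subseteq> {..<m}"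
  shows "card {xs \<in> fixed_lists V m I f. \<exists>j<m. j \<notin> I \<and> xs ! j \<in> B}
    \<le> (m - card I) * card B * card V ^ (m - Suc (card I))"
proof -
  let ?J = "{..<m} - I"
  let ?S = "\<lambda>(j, b). fixed_lists V m (insert j I) (f(j := b))"
  have fI: "finite I" using assms(3) finite_subset by blast
  have "{xs \<in> fixed_lists V m I f. \<exists>j<m. j \<notin> I \<and> xs ! j \<in> B} \<subseteq> (\<Union>p\<in>?J \<times> B. ?S p)"
    by (fastforce simp: fixed_lists_def)
  moreover have "finite (\<Union>p\<in>?J \<times> B. ?S p)"
    using assms by (auto simp: finite_fixed_lists)
  ultimately have "card {xs \<in> fixed_lists V m I f. \<exists>j<m. j \<notin> I \<and> xs ! j \<in> B}
      \<le> card (\<Union>p\<in>?J \<times> B. ?S p)" by (rule card_mono[rotated])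
  also have "\<dots> \<le> card (?J \<times> B) * card V ^ (m - Suc (card I))"
  proof (rule card_UN_bound)
    fix p assume "p \<in> ?J \<times> B"
    then show "card (?S p) \<le> card V ^ (m - Suc (card I))"
      using card_fixed_lists[OF assms(1), of "insert (fst p) I" m "f(fst p := snd p)"] assms(3) fI
      by (auto simp: card_insert_if)
  qed (use assms in auto)
  also have "card (?J \<times> B) = (m - card I) * card B"
    using assms(3) fI by (simp add: card_cartesian_product card_Diff_subset)
  finally show ?thesis .
qed

text \<open>Fix one of the two entries in \<open>B\<close> and apply
  \<open>card_fixed_lists_hit\<close> to the other; the numbers of positions are rounded up to
  \<open>m\<close>.\<close>

lemma card_fixed_lists_hit2:
  assumes "finite V" "finite B" "I \<subseteq> {..<m}"
  shows "card {xs \<in> fixed_lists V m I f.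
      \<exists>i<m. \<exists>j<m. i \<notin> I \<and> j \<notin> I \<and> i \<noteq> j \<and> xs ! i \<in> B \<and> xs ! j \<in> B}
    \<le> (m * card B)\<^sup>2 * card V ^ (m - (card I + 2))"
proof -
  let ?J = "{..<m} - I"
  let ?S = "\<lambda>(j, b). {xs \<in> fixed_lists V m (insert j I) (f(j := b)).
     \<exists>i<m. i \<notin> insert j I \<and> xs ! i \<in> B}"
  let ?L = "{xs \<in> fixed_lists V m I f.
      \<exists>i<m. \<exists>j<m. i \<notin> I \<and> j \<notin> I \<and> i \<noteq> j \<and> xs ! i \<in> B \<and> xs ! j \<in> B}"
  have fI: "finite I" using assms(3) finite_subset by blast
  have "?L \<subseteq> (\<Union>p\<in>?J \<times> B. ?S p)"
  proof
    fix xs assume "xs \<in> ?L"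
    then obtain i j where ij: "i < m" "j < m" "i \<notin> I" "j \<notin> I" "i \<noteq> j" "xs ! i \<in> B" "xs ! j \<in> B"
      and xs: "xs \<in> fixed_lists V m I f" by blast
    then have "xs \<in> ?S (j, xs ! j)" by (auto simp: fixed_lists_def)
    then show "xs \<in> (\<Union>p\<in>?J \<times> B. ?S p)" using ij by blast
  qed
  moreover have "finite (\<Union>p\<in>?J \<times> B. ?S p)"
    using assms by (auto simp: finite_fixed_lists)
  ultimately have "card ?L \<le> card (\<Union>p\<in>?J \<times> B. ?S p)" by (rule card_mono[rotated])
  also have "\<dots> \<le> card (?J \<times> B) * (m * card B * card V ^ (m - (card I + 2)))"
  proof (rule card_UN_bound)
    fix p assume p: "p \<in> ?J \<times> B"
    obtain j b where jb: "p = (j, b)" by (cases p)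
    have "card (?S p) \<le> (m - Suc (card I)) * card B * card V ^ (m - Suc (Suc (card I)))"
      using card_fixed_lists_hit[OF assms(1,2), of "insert j I" m "f(j := b)"] assms(3) fI p jb
      by (auto simp: card_insert_if)
    also have "\<dots> \<le> m * card B * card V ^ (m - (card I + 2))"
      by (intro mult_mono) auto
    finally show "card (?S p) \<le> m * card B * card V ^ (m - (card I + 2))" .
  qed (use assms in auto)
  also have "\<dots> \<le> (m * card B) * (m * card B * card V ^ (m - (card I + 2)))"
    using assms(3) fI by (intro mult_right_mono) (simp_all add: card_cartesian_product card_Diff_subset)
  finally show ?thesis by (simp add: power2_eq_square mult_ac)
qed

subsection \<open>Ends of longest paths\<close>

lemma longest_path_exists:
  assumes "finite V" "V \<noteq> {}"
  obtains P where "dpath E P" "set P \<subseteq> V" "P \<noteq> []"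
    "\<And>R. dpath E R \<Longrightarrow> set R \<subseteq> V \<Longrightarrow> length R \<le> length P"
proof -
  let ?Pr = "\<lambda>P. dpath E P \<and> set P \<subseteq> V"
  have bound: "length P < Suc (card V)" if "?Pr P" for P
    using that assms(1) by (metis card_mono distinct_card dpath_def le_imp_less_Suc)
  obtain x where "x \<in> V" using assms(2) by blast
  then have "?Pr [x]" by simp
  then obtain P where P: "?Pr P" "\<forall>R. ?Pr R \<longrightarrow> length R \<le> length P"
    using ex_has_greatest_nat[of ?Pr "[x]" length "Suc (card V)"] bound by blast
  then have "P \<noteq> []" using \<open>?Pr [x]\<close> by fastforce
  then show ?thesis using that P by blast
qed

lemma dpath_Cons_append:
  "dpath E (xs @ u # ys) \<longleftrightarrow> dpath E (xs @ [u]) \<and> dpath E (u # ys) \<and> set xs \<inter> set ys = {}"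
  by (auto simp: dpath_append dpath_Cons)

text \<open>Turns a bound on the distance of \<open>q\<close> from the end of a path into membership
  in a set of at most \<open>m\<close> vertices that depends only on the path.\<close>

lemma in_set_drop_last:
  assumes "Q = Q0 @ q # Q1" "length Q1 < m"
  shows "q \<in> set (drop (length Q - m) Q)"
proof -
  have "length Q - m \<le> length Q0" using assms by simp
  then show ?thesis using assms(1) by simp
qed

lemma card_set_drop_last: "card (set (drop (length Q - m) Q)) \<le> m"
  by (rule order_trans[OF card_length]) simp

locale bounded_circumference =
  fixes V :: "'a set" and E :: "'a rel" and k :: nat
  assumes finV: "finite V" and EV: "E \<subseteq> V \<times> V"
    and circ: "dcycle E xs \<Longrightarrow> length xs \<le> k"
begin

text \<open>The arc closes the segment from \<open>q\<close> onwards to a cycle, whose length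
  \<open>circ\<close> bounds.\<close>

lemma back_arc:
  assumes "dpath E (R @ q # S)" "(last (q # S), q) \<in> E"
  shows "length S < k"
proof -
  have "dcycle E (q # S)" using assms by (auto simp: dcycle_iff dpath_append)
  from circ[OF this] show ?thesis by simp
qed

lemma dcycle_fixed:
  assumes "dcycle E xs" "length xs = l" "\<And>i. i \<in> I \<Longrightarrow> xs ! i = f i"
  shows "xs \<in> fixed_lists V l I f"
  using assms dcycle_subset[OF assms(1) EV] by (simp add: fixed_lists_def)

text \<open>The successor of the end on a cycle lies on \<open>P\<close> by maximality, among the
  last \<open>k\<close> vertices by \<open>back_arc\<close>, and is not the end itself because
  \<open>l\<close> is at least 2. This leaves \<open>k - 1\<close> choices for it and
  \<open>l - 2\<close> free positions.\<close>

lemma card_cycles_through_end: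
  assumes P: "dpath E P" "set P \<subseteq> V" "P \<noteq> []"
    and longest: "\<And>R. dpath E R \<Longrightarrow> set R \<subseteq> V \<Longrightarrow> length R \<le> length P"
    and l: "2 \<le> l"
  shows "card {c \<in> cycles E l. last P \<in> Domain c} \<le> (k - 1) * card V ^ (l - 2)"
proof -
  let ?z = "last P"
  let ?N = "set (drop (length P - k) P) - {?z}"
  let ?f = "\<lambda>y i. if i = 0 then y else ?z"
  let ?S = "\<lambda>y. fixed_lists V l {0, l - 1} (?f y)"
  have "{c \<in> cycles E l. ?z \<in> Domain c} \<subseteq> arcset ` (\<Union>y\<in>?N. ?S y)"
  proof
    fix c assume c: "c \<in> {c \<in> cycles E l. ?z \<in> Domain c}"
    then obtain xs where xs: "dcycle E xs" "length xs = l" "c = arcset xs" "xs ! (l - 1) = ?z"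
      using cycles_obtain_nth[of c E l ?z "l - 1"] l by auto
    let ?y = "xs ! 0"
    have "xs \<noteq> []" using xs l by auto
    then have arc: "(?z, ?y) \<in> E"
      using xs by (auto simp: dcycle_iff last_conv_nth hd_conv_nth)
    then have "?y \<in> V" using EV by auto
    have "?y \<in> set P"
    proof (rule ccontr)
      assume "?y \<notin> set P"
      then have "dpath E (P @ [?y])" using P arc by (simp add: dpath_append)
      then show False using longest[of "P @ [?y]"] P \<open>?y \<in> V\<close> by simp
    qed
    then obtain P0 P1 where P01: "P = P0 @ ?y # P1" by (meson split_list)
    have "length P1 < k"
      using back_arc[of P0 ?y P1] P(1) arc P01 by (metis last_appendR list.distinct(1))
    moreover have "?y \<noteq> ?z"
    proof -
      have "distinct xs" using xs by (simp add: dcycle_def)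
      then show ?thesis using xs l nth_eq_iff_index_eq[of xs 0 "l - 1"] by simp
    qed
    ultimately have "?y \<in> ?N" using in_set_drop_last[OF P01] by simp
    moreover have "xs \<in> ?S ?y" using xs by (intro dcycle_fixed) auto
    ultimately show "c \<in> arcset ` (\<Union>y\<in>?N. ?S y)" using xs(3) by blast
  qed
  then have "card {c \<in> cycles E l. ?z \<in> Domain c} \<le> card (\<Union>y\<in>?N. ?S y)"
    by (rule surj_card_le[rotated]) (simp add: finite_fixed_lists finV)
  also have "\<dots> \<le> card ?N * card V ^ (l - 2)"
  proof (rule card_UN_bound)
    fix y
    have "card {0, l - 1} = 2" using l by auto
    then show "card (?S y) \<le> card V ^ (l - 2)"
      using card_fixed_lists[OF finV, of "{0, l - 1}" l "?f y"] l by (auto simp: numeral_2_eq_2)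
  qed simp
  also have "card ?N \<le> k - 1"
  \<comment> \<open>The end is itself one of the last \<open>k\<close> vertices, which improves the
    factor from \<open>k\<close> to \<open>k - 1\<close>; this precision matters when
    \<open>k = 2\<close>.\<close>
  proof (cases "k = 0")
    case False
    then have "?z \<in> set (drop (length P - k) P)"
      using in_set_drop_last[of P "butlast P" ?z "[]" k] P(3) by simp
    then show ?thesis
      using card_set_drop_last[of P k] by simp
  qed simp
  finally show ?thesis by simp
qed

lemma restrict: "bounded_circumference (V - A) (E \<inter> (V - A) \<times> (V - A)) k"
  by unfold_locales (use finV circ dcycle_mono in blast)+

lemma card_cycles_restrict:
  "card (cycles E l) \<le> card (cycles (E \<inter> (V - A) \<times> (V - A)) l)
     + card {c \<in> cycles E l. Domain c \<inter> A \<noteq> {}}"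
  by (subst cycles_restrict[OF EV, of l A]) (rule card_Un_le)

end

text \<open>Ends of longest paths are deleted one after another, and the losses from
  \<open>card_cycles_through_end\<close> add up. For \<open>l < k\<close> this is an error term; for
  \<open>l = k = 2\<close> the factor \<open>k - 1 = 1\<close> gives the exact leading term.\<close>

lemma card_cycles_le:
  assumes "bounded_circumference V E k" "2 \<le> l"
  shows "card (cycles E l) \<le> (k - 1) * card V ^ (l - 1)"
  using assms(1)
proof (induction "card V" arbitrary: V E)
  case 0
  interpret bounded_circumference V E k by fact
  have "E = {}" using 0 finV EV by auto
  then have "cycles E l = {}" by (auto simp: cycles_def dcycle_iff)
  then show ?case by simp
next
  case (Suc n)
  interpret bounded_circumference V E k by fact
  have "V \<noteq> {}" using Suc by auto
  then obtain P where P: "dpath E P" "set P \<subseteq> V" "P \<noteq> []"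
    "\<And>R. dpath E R \<Longrightarrow> set R \<subseteq> V \<Longrightarrow> length R \<le> length P"
    using longest_path_exists[OF finV] by metis
  let ?z = "last P"
  let ?E = "E \<inter> (V - {?z}) \<times> (V - {?z})"
  have z: "?z \<in> V" using P by auto
  then have n: "n = card (V - {?z})" using Suc.hyps(2) finV by simp
  have "card (cycles E l) \<le> card (cycles ?E l) + card {c \<in> cycles E l. Domain c \<inter> {?z} \<noteq> {}}"
    by (rule card_cycles_restrict)
  also have "\<dots> \<le> (k - 1) * n ^ (l - 1) + (k - 1) * Suc n ^ (l - 2)"
  proof (rule add_mono)
    show "card (cycles ?E l) \<le> (k - 1) * n ^ (l - 1)"
      using Suc.hyps(1)[OF n restrict] n by simp
    show "card {c \<in> cycles E l. Domain c \<inter> {?z} \<noteq> {}} \<le> (k - 1) * Suc n ^ (l - 2)"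
      using card_cycles_through_end[OF P assms(2)] Suc.hyps(2) by simp
  qed
  also have "\<dots> = (k - 1) * (n * n ^ (l - 2) + Suc n ^ (l - 2))"
  proof -
    have "l - 1 = Suc (l - 2)" using assms(2) by simp
    then show ?thesis by (simp only: power_Suc distrib_left)
  qed
  also have "\<dots> \<le> (k - 1) * (n * Suc n ^ (l - 2) + Suc n ^ (l - 2))"
    by (intro mult_left_mono add_mono power_mono) auto
  also have "\<dots> = (k - 1) * Suc n ^ Suc (l - 2)" by simp
  also have "Suc (l - 2) = l - 1" using assms(2) by simp
  finally show ?case using Suc.hyps(2) by simp
qed

subsection \<open>Cycles through a hub\<close>

text \<open>
  The path \<open>Q @ [v]\<close> is what remains of a longest path after its last \<open>k - 1\<close> vertices are cut off;
  hence \<open>Q @ xs\<close> is a longest path for every \<open>k\<close>-cycle \<open>xs\<close> that starts in \<open>v\<close> and avoids \<open>Q\<close>.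
\<close>

locale hub = bounded_circumference +
  fixes Q :: "'a list" and v :: 'a
  assumes hub_path: "dpath E (Q @ [v])" and hub_set: "set (Q @ [v]) \<subseteq> V"
    and longest: "dpath E R \<Longrightarrow> set R \<subseteq> V \<Longrightarrow> length R \<le> length Q + k"
    and k3: "3 \<le> k"
begin

definition hub_cycles :: "'a list set" where
  "hub_cycles = {xs. dcycle E xs \<and> length xs = k \<and> xs ! 0 = v \<and> set xs \<inter> set Q = {}}"

text \<open>The width \<open>2 * k\<close> allows for two hits: the first lies among the last
  \<open>k\<close> vertices of \<open>Q\<close>, the second at most about \<open>k\<close> further
  back.\<close>

definition near :: "'a set" where
  "near = set (drop (length Q - 2 * k) Q)"

lemma finite_near: "finite near" by (simp add: near_def)

lemma card_near: "card near \<le> 2 * k" unfolding near_def by (rule card_set_drop_last)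

lemma in_near: "Q = Q0 @ q # Q1 \<Longrightarrow> length Q1 < 2 * k \<Longrightarrow> q \<in> near"
  unfolding near_def by (rule in_set_drop_last)

lemma hub_append:
  assumes "xs \<in> hub_cycles" "xs = T @ S" "T \<noteq> []"
  shows "dpath E (Q @ T)" "hd T = v" "set T \<subseteq> V"
proof -
  have xs: "dcycle E xs" "xs ! 0 = v" "set xs \<inter> set Q = {}" using assms by (auto simp: hub_cycles_def)
  show hd: "hd T = v" using xs(2) assms(2,3) by (simp add: hd_conv_nth nth_append)
  show "set T \<subseteq> V" using dcycle_subset[OF xs(1) EV] assms(2) by auto
  show "dpath E (Q @ T)"
    using xs assms(2,3) hub_path hd by (auto simp: dpath_append dcycle_iff)
qed

text \<open>
  If \<open>K\<close> missed \<open>Q\<close>, then \<open>Q @ T @ K\<close> would be too long a path. If it met \<open>Q\<close> in a single vertex \<open>q\<close>,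
  then one could follow \<open>Q\<close> up to \<open>q\<close>, then \<open>K\<close> up to \<open>u\<close>, and then \<open>xs\<close> back to \<open>v\<close>; this path is too
  long because the segment of \<open>Q\<close> after \<open>q\<close> lies on a cycle with \<open>T\<close> and the beginning of \<open>K\<close>.
\<close>

lemma avoiding_cycle_hits_twice:
  assumes xs: "xs \<in> hub_cycles" "xs = T @ u # D" "T \<noteq> []"
    and K: "dcycle E K" "length K = k" "K = u # bs" "v \<notin> set K"
    and disj: "set xs \<inter> set bs = {}"
  shows "\<exists>a<k. \<exists>b<k. a \<notin> {0} \<and> b \<notin> {0} \<and> a \<noteq> b \<and> K ! a \<in> near \<and> K ! b \<in> near"
proof -
  have len: "length T + Suc (length D) = k" using xs(1,2) by (simp add: hub_cycles_def)
  have xsQ: "set xs \<inter> set Q = {}" and xsc: "dcycle E xs" using xs(1) by (simp_all add: hub_cycles_def)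
  have T: "dpath E (Q @ T @ [u])" "hd T = v" "set T \<subseteq> V"
    using hub_append[OF xs(1), of "T @ [u]" D] hub_append[OF xs] xs by auto
  have KV: "set K \<subseteq> V" using dcycle_subset[OF K(1) EV] .
  have Kp: "dpath E (u # bs)" "(last (u # bs), u) \<in> E" using K(1,3) by (auto simp: dcycle_iff)
  have Tbs: "set T \<inter> set bs = {}" using disj xs(2) by auto
  have QV: "set Q \<subseteq> V" using hub_set by simp
  have uQ: "u \<notin> set Q" using xsQ xs(2) by auto
  have "set bs \<inter> set Q \<noteq> {}"
  proof
    assume *: "set bs \<inter> set Q = {}"
    have "dpath E ((Q @ T) @ u # bs)"
      using T(1) Kp(1) Tbs * by (subst dpath_Cons_append) auto
    then have "length (Q @ T @ u # bs) \<le> length Q + k"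
      using longest[of "(Q @ T) @ u # bs"] T(3) KV QV K(3) by auto
    then show False using K(2,3) xs(3) by (cases T) auto
  qed
  then obtain cs q ds where bs: "bs = cs @ q # ds" and q: "q \<in> set Q" and cs: "set cs \<inter> set Q = {}"
    using split_list_first_prop[of bs "\<lambda>x. x \<in> set Q"] by blast
  obtain Q0 Q1 where Q: "Q = Q0 @ q # Q1" using q by (meson split_list)
  have dQ: "distinct Q" using hub_path by (simp add: dpath_def)
  have "dpath E ((Q @ T) @ u # cs)"
    using T(1) Kp(1) Tbs cs bs by (subst dpath_Cons_append) (auto simp: dpath_append dpath_Cons)
  moreover have "(last (u # cs), q) \<in> E"
    using Kp(1) bs by (cases cs) (auto simp: dpath_append dpath_Cons)
  ultimately have L1: "length (Q1 @ T @ u # cs) < k"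
    using back_arc[of Q0 q "Q1 @ T @ u # cs"] Q by simp
  have nth1: "K ! Suc (length cs) = q" using K(3) bs by simp
  have qB: "q \<in> near" using in_near[OF Q] L1 by simp
  have "set ds \<inter> set Q \<noteq> {}"
  proof
    assume ds: "set ds \<inter> set Q = {}"
    have "dpath E (Q0 @ [q])" using hub_path Q by (auto simp: dpath_append dpath_Cons)
    moreover have "dpath E (q # ds)" using Kp(1) bs by (auto simp: dpath_append dpath_Cons)
    ultimately have p1: "dpath E (Q0 @ q # ds)"
      using ds Q by (subst dpath_Cons_append) auto
    have "dpath E ((u # D) @ [v])"
    proof (subst dpath_append, intro conjI)
      have "v \<in> set T" using T(2) xs(3) by auto
      then show "set (u # D) \<inter> set [v] = {}" "dpath E (u # D)"
        using xsc xs(2) by (auto simp: dcycle_iff dpath_append)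
      show "u # D = [] \<or> [v] = [] \<or> (last (u # D), hd [v]) \<in> E"
        using xsc xs(2,3) T(2) by (simp add: dcycle_iff hd_append)
    qed simp
    then have p2: "dpath E (u # D @ [v])" by simp
    have "dpath E ((Q0 @ q # ds) @ u # D @ [v])"
    proof (subst dpath_append, intro conjI p1 p2)
      have "(last (q # ds), u) \<in> E" using Kp(2) bs by simp
      then show "Q0 @ q # ds = [] \<or> u # D @ [v] = [] \<or>
          (last (Q0 @ q # ds), hd (u # D @ [v])) \<in> E" by simp
      have "set (q # ds) \<inter> set (u # D) = {}"
        using disj bs xs(2) Kp(1) by (auto simp: dpath_Cons)
      moreover have "set Q0 \<inter> set (u # D) = {}" using xsQ Q xs(2) by auto
      moreover have "v \<notin> set Q0" using hub_path Q by (auto simp: dpath_append)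
      moreover have "v \<notin> set (q # ds)" using K(3,4) bs by auto
      ultimately show "set (Q0 @ q # ds) \<inter> set (u # D @ [v]) = {}" by auto
    qed
    moreover have "set ((Q0 @ q # ds) @ u # D @ [v]) \<subseteq> V"
      using KV QV K(3) bs Q hub_set dcycle_subset[OF xsc EV] xs(2) by auto
    ultimately have "length ((Q0 @ q # ds) @ u # D @ [v]) \<le> length Q + k"
      by (rule longest)
    \<comment> \<open>This is what remains after cancelling common lengths; \<open>L1\<close>
      together with \<open>length K = k\<close> gives the opposite inequality.\<close>
    then have "Suc (length ds) \<le> length Q1 + length T" using Q len by simp
    moreover have "length Q1 + length T \<le> length ds" using L1 K(2,3) bs by simp
    ultimately show False by simp
  qed
  then obtain es q' fs where ds: "ds = es @ q' # fs" and q': "q' \<in> set Q" and es: "set es \<inter> set Q = {}"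
    using split_list_first_prop[of ds "\<lambda>x. x \<in> set Q"] by blast
  have "q' \<noteq> q" using Kp(1) bs ds by (auto simp: dpath_def)
  \<comment> \<open>After \<open>q\<close> on \<open>Q\<close>, the bound \<open>L1\<close>
    suffices. Before \<open>q\<close>, the piece of \<open>K\<close> from \<open>q\<close> to
    \<open>q'\<close> closes a cycle with the piece of \<open>Q\<close> from \<open>q'\<close> to
    \<open>q\<close>, and the two bounds add up to less than \<open>2 * k\<close>.\<close>
  have "q' \<in> near"
  proof (cases "q' \<in> set Q1")
    case True
    then obtain Q2 Q3 where "Q1 = Q2 @ q' # Q3" by (meson split_list)
    then show ?thesis using in_near[of "Q0 @ q # Q2" q' Q3] Q L1 by simp
  next
    case False
    then have "q' \<in> set Q0" using q' Q \<open>q' \<noteq> q\<close> by auto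
    then obtain Q2 Q3 where Q23: "Q0 = Q2 @ q' # Q3" by (meson split_list)
    have "dpath E (Q0 @ [q])" using hub_path Q by (auto simp: dpath_append dpath_Cons)
    then have "dpath E ((Q2 @ q' # Q3) @ [q])" using Q23 by simp
    moreover have "dpath E (q # es)" using Kp(1) bs ds by (auto simp: dpath_append dpath_Cons)
    ultimately have "dpath E ((Q2 @ q' # Q3) @ q # es)"
      using es Q Q23 by (subst dpath_Cons_append) auto
    moreover have "(last (q # es), q') \<in> E"
      using Kp(1) bs ds by (cases es) (auto simp: dpath_append dpath_Cons)
    ultimately have "length (Q3 @ q # es) < k"
      using back_arc[of Q2 q' "Q3 @ q # es"] by simp
    then show ?thesis using in_near[of Q2 q' "Q3 @ q # Q1"] Q Q23 L1 by simp
  qed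
  moreover have nth2: "K ! Suc (Suc (length cs + length es)) = q'"
    using K(3) bs ds by (simp add: nth_append)
  moreover have "Suc (Suc (length cs + length es)) < k" using K(2,3) bs ds by simp
  ultimately have "Suc (length cs) < k \<and> Suc (Suc (length cs + length es)) < k \<and>
      K ! Suc (length cs) \<in> near \<and> K ! Suc (Suc (length cs + length es)) \<in> near"
    using qB nth1 by auto
  moreover have "Suc (length cs) \<notin> {0}" "Suc (Suc (length cs + length es)) \<notin> {0}"
    "Suc (length cs) \<noteq> Suc (Suc (length cs + length es))" by auto
  ultimately show ?thesis by blast
qed

end

section \<open>Cycles of length \<open>k\<close> through the end of a longest path\<close>

context bounded_circumference
begin

definition through :: "'a \<Rightarrow> 'a rel set" where
  "through u = {c \<in> cycles E k. u \<in> Domain c}"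

lemma finite_through: "finite (through u)"
  unfolding through_def using finite_cycles[OF finV EV] by simp

text \<open>Following \<open>R\<close> and then \<open>xs\<close> up to its first vertex on
  \<open>R\<close> gives a path with an arc back into \<open>R\<close>, so \<open>back_arc\<close>
  applies. As \<open>y\<close> is not on \<open>R\<close>, the hit has a positive position.\<close>

lemma first_hit_bounded:
  assumes R: "dpath E (R @ [y])" and xs: "dcycle E xs" "length xs = k" "xs ! 0 = y"
    and hit: "set xs \<inter> set R \<noteq> {}"
  obtains a where "0 < a" "a < k" "xs ! a \<in> set (drop (length R - k) R)"
proof -
  obtain cs q ds where split: "xs = cs @ q # ds" and q: "q \<in> set R" and cs: "set cs \<inter> set R = {}"
    using hit split_list_first_prop[of xs "\<lambda>x. x \<in> set R"] by blast
  have y: "y \<notin> set R" using R by (simp add: dpath_append)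
  have ne: "cs \<noteq> []" using y q split xs(3) by auto
  have hd: "hd cs = y" using ne split xs(3) by (simp add: hd_conv_nth nth_append)
  have dxs: "dpath E (cs @ q # ds)" using xs(1) split by (simp add: dcycle_iff)
  obtain R0 R1 where R01: "R = R0 @ q # R1" using q by (meson split_list)
  have "dpath E (R @ cs)"
    using R dxs cs hd ne by (auto simp: dpath_append)
  then have "dpath E (R0 @ q # R1 @ cs)" using R01 by simp
  moreover have "(last (q # R1 @ cs), q) \<in> E"
    using dxs ne by (auto simp: dpath_append)
  ultimately have "length (R1 @ cs) < k" by (rule back_arc)
  then have "q \<in> set (drop (length R - k) R)" using in_set_drop_last[OF R01] by simp
  then show ?thesis using that[of "length cs"] ne split xs(2) by auto
qed

text \<open>Let \<open>y\<close> follow the end on the cycle and split \<open>P\<close> as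
  \<open>P0 @ y # P1\<close>. If the cycle misses \<open>P0\<close>, then \<open>P0 @ xs\<close> is
  a path, so \<open>P1\<close> has at least \<open>k - 1\<close> vertices, and by
  \<open>back_arc\<close> no more: \<open>y\<close> is the hub. Otherwise
  \<open>first_hit_bounded\<close> confines a third entry to a bounded set.\<close>

lemma cycles_at_end_of_longest_path:
  assumes P: "dpath E P" "set P \<subseteq> V" "P \<noteq> []"
    and longest: "\<And>R. dpath E R \<Longrightarrow> set R \<subseteq> V \<Longrightarrow> length R \<le> length P"
    and k: "3 \<le> k"
  shows "card (through (last P)) \<le> card {xs. dcycle E xs \<and> length xs = k \<and> k \<le> length P \<and>
       xs ! 0 = P ! (length P - k) \<and> xs ! (k - 1) = last P \<and>
       set xs \<inter> set (take (length P - k) P) = {}} + k ^ 4 * card V ^ (k - 3)"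
    (is "_ \<le> card ?G + _")
proof -
  let ?z = "last P"
  let ?Y = "set (drop (length P - k) P)"
  \<comment> \<open>\<open>takeWhile\<close> recovers \<open>P0\<close> from \<open>y\<close>, so
    the candidates for the hit depend on \<open>P\<close> and \<open>y\<close> alone.\<close>
  let ?C = "\<lambda>y. set (drop (length (takeWhile (\<lambda>x. x \<noteq> y) P) - k) (takeWhile (\<lambda>x. x \<noteq> y) P))"
  let ?F = "\<lambda>y. {xs \<in> fixed_lists V k {0, k - 1} (\<lambda>i. if i = 0 then y else ?z).
      \<exists>a<k. a \<notin> {0, k - 1} \<and> xs ! a \<in> ?C y}"
  have "through ?z \<subseteq> arcset ` (?G \<union> (\<Union>y\<in>?Y. ?F y))"
  proof
    fix c assume c: "c \<in> through ?z"
    obtain xs where xs: "dcycle E xs" "length xs = k" "c = arcset xs" "xs ! (k - 1) = ?z"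
      using cycles_obtain_nth[of c E k ?z "k - 1"] c k by (auto simp: through_def)
    let ?y = "xs ! 0"
    have "xs \<noteq> []" using xs k by auto
    then have arc: "(?z, ?y) \<in> E"
      using xs by (auto simp: dcycle_iff last_conv_nth hd_conv_nth)
    then have "?y \<in> V" using EV by auto
    have "?y \<in> set P"
    proof (rule ccontr)
      assume "?y \<notin> set P"
      then have "dpath E (P @ [?y])" using P arc by (simp add: dpath_append)
      then show False using longest[of "P @ [?y]"] P \<open>?y \<in> V\<close> by simp
    qed
    then obtain P0 P1 where P01: "P = P0 @ ?y # P1" by (meson split_list)
    have dP: "distinct P" using P(1) by (simp add: dpath_def)
    have P0: "takeWhile (\<lambda>x. x \<noteq> ?y) P = P0"
    proof -
      have "?y \<notin> set P0" using dP P01 by (metis disjoint_iff distinct_append list.set_intros(1))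
      then have "takeWhile (\<lambda>x. x \<noteq> ?y) (P0 @ ?y # P1) = P0"
        by (subst takeWhile_append2) auto
      then show ?thesis using P01 by metis
    qed
    have P1: "length P1 < k"
      using back_arc[of P0 ?y P1] P(1) arc P01 by (metis last_appendR list.distinct(1))
    have zP0: "?z \<notin> set P0"
      using dP P01 by (metis disjoint_iff distinct_append last_appendR last_in_set list.distinct(1))
    have P0y: "dpath E (P0 @ [?y])" using P(1) P01 by (auto simp: dpath_append dpath_Cons)
    show "c \<in> arcset ` (?G \<union> (\<Union>y\<in>?Y. ?F y))"
    proof (cases "set xs \<inter> set P0 = {}")
      case True
      have "dpath E (P0 @ xs)"
        using True P0y xs(1) \<open>xs \<noteq> []\<close> by (auto simp: dpath_append dcycle_iff hd_conv_nth)
      moreover have "set (P0 @ xs) \<subseteq> V"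
        using P(2) P01 dcycle_subset[OF xs(1) EV] by auto
      ultimately have "length (P0 @ xs) \<le> length P" by (rule longest)
      moreover have "length P = length P0 + Suc (length P1)" using arg_cong[OF P01, of length] by simp
      ultimately have len: "length P - k = length P0" "k \<le> length P"
        using P1 xs(2) by auto
      have "P ! length P0 = ?y" "take (length P0) P = P0"
        by (subst P01, simp)+
      then have "xs \<in> ?G" using xs True len by simp
      then show ?thesis using xs(3) by blast
    next
      case False
      then obtain a where a: "0 < a" "a < k" "xs ! a \<in> set (drop (length P0 - k) P0)"
        using first_hit_bounded[OF P0y xs(1,2)] by blast
      \<comment> \<open>The hit has to be a third position, distinct from the two already
        fixed.\<close>
      then have "a \<noteq> k - 1" using zP0 xs(4) in_set_dropD by fastforce
      then have "xs \<in> ?F ?y"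
        using a P0 xs by (auto intro!: dcycle_fixed)
      moreover have "?y \<in> ?Y" using in_set_drop_last[OF P01 P1] .
      ultimately show ?thesis using xs(3) by blast
    qed
  qed
  moreover have fin: "finite ?G" "finite (\<Union>y\<in>?Y. ?F y)"
    using finite_dcycles[OF finV EV] by (auto simp: finite_fixed_lists finV)
  ultimately have "card (through ?z) \<le> card (?G \<union> (\<Union>y\<in>?Y. ?F y))"
    by (intro surj_card_le) auto
  also have "\<dots> \<le> card ?G + card (\<Union>y\<in>?Y. ?F y)" by (rule card_Un_le)
  also have "card (\<Union>y\<in>?Y. ?F y) \<le> card ?Y * (k * k * card V ^ (k - 3))"
  proof (rule card_UN_bound)
    fix y
    have two: "card {0, k - 1} = 2" using k by auto
    have "card (?F y) \<le> (k - 2) * card (?C y) * card V ^ (k - Suc 2)"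
      using card_fixed_lists_hit[OF finV, of "?C y" "{0, k - 1}" k "\<lambda>i. if i = 0 then y else ?z"] k
      unfolding two by simp
    also have "\<dots> \<le> k * k * card V ^ (k - 3)"
      using card_set_drop_last[of "takeWhile (\<lambda>x. x \<noteq> y) P" k]
      by (intro mult_mono) (auto simp: numeral_3_eq_3)
    finally show "card (?F y) \<le> k * k * card V ^ (k - 3)" .
  qed simp
  also have "\<dots> \<le> k ^ 2 * (k * k * card V ^ (k - 3))"
    using card_set_drop_last[of P k] k
    by (intro mult_right_mono) (auto simp: power2_eq_square intro: order_trans)
  also have "\<dots> = k ^ 4 * card V ^ (k - 3)"
    by (simp add: power2_eq_square power4_eq_xxxx)
  finally show ?thesis by simp
qed

end

section \<open>Flexible vertices, stray cycles and layers\<close>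

context hub
begin

abbreviation "n \<equiv> card V"

text \<open>
  \<open>Z\<close> will be empty or consist of the end of a longest path, which all the cycles at hand may share.
\<close>

definition flexible :: "'a \<Rightarrow> nat \<Rightarrow> 'a set \<Rightarrow> bool" where
  "flexible u i Z \<longleftrightarrow> (\<forall>S. finite S \<and> card S \<le> k \<and> S \<inter> insert u (insert v Z) = {} \<longrightarrow>
     (\<exists>xs\<in>hub_cycles. xs ! i = u \<and> set xs \<inter> S = {}))"

definition hub_cycles_at :: "nat \<Rightarrow> 'a \<Rightarrow> 'a list set" where
  "hub_cycles_at i u = {xs \<in> hub_cycles. xs ! i = u}"

text \<open>The threshold bounds the number of lists with \<open>v\<close> and \<open>u\<close>
  fixed and a further entry in a given set of at most \<open>k\<close> vertices; exceeding it yields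
  \<open>layer_flexible\<close>.\<close>

definition layer :: "nat \<Rightarrow> 'a set" where
  "layer i = {u \<in> V. k * k * n ^ (k - 3) < card (hub_cycles_at i u)}"

lemma finite_hub_cycles: "finite hub_cycles"
  using finite_dcycles[OF finV EV] by (simp add: hub_cycles_def)

lemma finite_hub_cycles_at: "finite (hub_cycles_at i u)"
  using finite_hub_cycles by (simp add: hub_cycles_at_def)

lemma hub_cycles_nth:
  assumes "xs \<in> hub_cycles" "0 < i" "i < k"
  shows "xs ! i \<in> V" "xs ! i \<noteq> v" "xs ! i \<notin> set Q"
proof -
  have xs: "dcycle E xs" "length xs = k" "xs ! 0 = v" "set xs \<inter> set Q = {}"
    using assms by (auto simp: hub_cycles_def)
  have "xs ! i \<in> set xs" using xs(2) assms(3) by simp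
  then show "xs ! i \<in> V" "xs ! i \<notin> set Q" using xs(4) dcycle_subset[OF xs(1) EV] by auto
  have "distinct xs" using xs(1) by (simp add: dcycle_def)
  then show "xs ! i \<noteq> v" using xs(2,3) assms(2,3) nth_eq_iff_index_eq[of xs i 0] by auto
qed

lemma flexibleE:
  assumes "flexible u i Z" "finite S" "card S \<le> k" "S \<inter> insert u (insert v Z) = {}"
  obtains xs where "xs \<in> hub_cycles" "xs ! i = u" "set xs \<inter> S = {}"
  using assms unfolding flexible_def by blast

lemma flexible_vertex:
  assumes "flexible u i Z" "0 < i" "i < k"
  shows "u \<in> V" "u \<noteq> v" "u \<notin> set Q"
proof -
  obtain xs where "xs \<in> hub_cycles" "xs ! i = u"
    using flexibleE[OF assms(1), of "{}"] by auto
  then show "u \<in> V" "u \<noteq> v" "u \<notin> set Q" using hub_cycles_nth assms(2,3) by blast+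
qed

text \<open>Flexibility supplies a hub cycle through \<open>u\<close> that misses all other vertices
  of \<open>K\<close>. By \<open>avoiding_cycle_hits_twice\<close> two entries of \<open>K\<close>
  then lie in \<open>near\<close>, so together with \<open>u\<close> three entries are
  restricted.\<close>

lemma card_cycles_avoiding_hub:
  assumes flex: "flexible u i Z" and i: "0 < i" "i < k"
  shows "card {c \<in> through u. v \<notin> Domain c \<and> Domain c \<inter> Z = {}} \<le> 4 * k ^ 4 * n ^ (k - 3)"
proof -
  let ?F = "{K \<in> fixed_lists V k {0} (\<lambda>_. u).
      \<exists>a<k. \<exists>b<k. a \<notin> {0} \<and> b \<notin> {0} \<and> a \<noteq> b \<and> K ! a \<in> near \<and> K ! b \<in> near}"
  have "{c \<in> through u. v \<notin> Domain c \<and> Domain c \<inter> Z = {}} \<subseteq> arcset ` ?F"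
  proof
    fix c assume c: "c \<in> {c \<in> through u. v \<notin> Domain c \<and> Domain c \<inter> Z = {}}"
    then obtain K where K: "dcycle E K" "length K = k" "c = arcset K" "K ! 0 = u"
      using cycles_obtain_nth[of c E k u 0] i by (auto simp: through_def)
    then obtain bs where bs: "K = u # bs" using i by (cases K) auto
    have "u \<notin> set bs" using K(1) bs by (simp add: dcycle_def)
    moreover have "card (set bs) \<le> k" using K(2) bs card_length[of bs] by simp
    moreover have "v \<notin> set K" "set K \<inter> Z = {}" using c K(3) by (auto simp: Domain_arcset)
    ultimately have "set bs \<inter> insert u (insert v Z) = {}" "card (set bs) \<le> k" using bs by auto
    then obtain xs where xs: "xs \<in> hub_cycles" "xs ! i = u" "set xs \<inter> set bs = {}"
      using flex unfolding flexible_def by blast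
    have "length xs = k" using xs(1) by (simp add: hub_cycles_def)
    then have "xs = take i xs @ u # drop (Suc i) xs" "take i xs \<noteq> []"
      using id_take_nth_drop[of i xs] i xs(2) by auto
    from avoiding_cycle_hits_twice[OF xs(1) this K(1,2) bs \<open>v \<notin> set K\<close> xs(3)]
    have "K \<in> ?F" using K by (auto intro!: dcycle_fixed)
    then show "c \<in> arcset ` ?F" using K(3) by blast
  qed
  then have "card {c \<in> through u. v \<notin> Domain c \<and> Domain c \<inter> Z = {}} \<le> card ?F"
    by (rule surj_card_le[rotated]) (simp add: finite_fixed_lists finV)
  also have "\<dots> \<le> (k * card near)\<^sup>2 * n ^ (k - 3)"
    using card_fixed_lists_hit2[OF finV finite_near, of "{0}" k "\<lambda>_. u"] i
    by (simp add: numeral_3_eq_3)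
  also have "\<dots> \<le> (k * (2 * k))\<^sup>2 * n ^ (k - 3)"
    using card_near by (intro mult_right_mono power_mono mult_left_mono) auto
  also have "(k * (2 * k))\<^sup>2 = 4 * k ^ 4"
    by (simp add: power2_eq_square power4_eq_xxxx)
  finally show ?thesis .
qed

text \<open>Listed from \<open>v\<close>, the cycle has a hit confined to \<open>k\<close> vertices
  by \<open>first_hit_bounded\<close>; as \<open>u\<close> is not on \<open>Q\<close>, this is a
  third restricted entry besides \<open>v\<close> and \<open>u\<close>.\<close>

lemma card_cycles_hitting_Q:
  assumes u: "u \<noteq> v" "u \<notin> set Q"
  shows "card {c \<in> through u. v \<in> Domain c \<and> Domain c \<inter> set Q \<noteq> {}} \<le> 2 * k ^ 4 * n ^ (k - 3)"
proof -
  let ?C = "set (drop (length Q - k) Q)"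
  let ?F = "\<lambda>j. {xs \<in> fixed_lists V k {0, j} (\<lambda>i. if i = 0 then v else u).
      \<exists>a<k. a \<notin> {0, j} \<and> xs ! a \<in> ?C}"
  have "{c \<in> through u. v \<in> Domain c \<and> Domain c \<inter> set Q \<noteq> {}} \<subseteq> arcset ` (\<Union>j\<in>{1..<k}. ?F j)"
  proof
    fix c assume c: "c \<in> {c \<in> through u. v \<in> Domain c \<and> Domain c \<inter> set Q \<noteq> {}}"
    then obtain xs where xs: "dcycle E xs" "length xs = k" "c = arcset xs" "xs ! 0 = v"
      using cycles_obtain_nth[of c E k v 0] k3 by (auto simp: through_def)
    have "u \<in> set xs" "set xs \<inter> set Q \<noteq> {}"
      using c xs(3) by (auto simp: through_def Domain_arcset)
    then obtain j where j: "j < k" "xs ! j = u" using xs(2) by (auto simp: in_set_conv_nth)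
    then have "j \<noteq> 0" using u(1) xs(4) by (metis)
    obtain a where a: "0 < a" "a < k" "xs ! a \<in> ?C"
      using first_hit_bounded[OF hub_path xs(1,2,4) \<open>set xs \<inter> set Q \<noteq> {}\<close>] by blast
    then have "a \<noteq> j" using u(2) j in_set_dropD by fastforce
    then have "xs \<in> ?F j" using a j xs \<open>j \<noteq> 0\<close> by (auto intro!: dcycle_fixed)
    moreover have "j \<in> {1..<k}" using j \<open>j \<noteq> 0\<close> by simp
    ultimately show "c \<in> arcset ` (\<Union>j\<in>{1..<k}. ?F j)" using xs(3) by blast
  qed
  then have "card {c \<in> through u. v \<in> Domain c \<and> Domain c \<inter> set Q \<noteq> {}} \<le> card (\<Union>j\<in>{1..<k}. ?F j)"
    by (rule surj_card_le[rotated]) (simp add: finite_fixed_lists finV)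
  also have "\<dots> \<le> card {1..<k} * (k * k * n ^ (k - 3))"
  proof (rule card_UN_bound)
    fix j assume j: "j \<in> {1..<k}"
    then have two: "card {0, j} = 2" by auto
    have "card (?F j) \<le> (k - 2) * card ?C * n ^ (k - Suc 2)"
      using card_fixed_lists_hit[OF finV, of ?C "{0, j}" k "\<lambda>i. if i = 0 then v else u"] j
      unfolding two by simp
    also have "\<dots> \<le> k * k * n ^ (k - 3)"
      using card_set_drop_last[of Q k] by (intro mult_mono) (auto simp: numeral_3_eq_3)
    finally show "card (?F j) \<le> k * k * n ^ (k - 3)" .
  qed simp
  also have "\<dots> \<le> (2 * k ^ 2) * (k * k * n ^ (k - 3))"
  proof (rule mult_right_mono)
    have "k \<le> 2 * (k * k)" by (cases k) auto
    then show "card {1..<k} \<le> 2 * k\<^sup>2" unfolding power2_eq_square by (simp only: card_atLeastLessThan)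
  qed simp
  also have "\<dots> = 2 * k ^ 4 * n ^ (k - 3)"
    by (simp add: power2_eq_square power4_eq_xxxx)
  finally show ?thesis .
qed

text \<open>These are the exceptions: the rest of \<open>through u\<close> consists of arc sets of
  hub cycles (\<open>not_stray_obtain\<close>).\<close>

definition stray :: "'a \<Rightarrow> 'a rel set" where
  "stray u = {c \<in> through u. v \<in> Domain c \<longrightarrow> Domain c \<inter> set Q \<noteq> {}}"

lemma card_stray:
  assumes flex: "flexible u i {}" and i: "0 < i" "i < k"
  shows "card (stray u) \<le> 6 * k ^ 4 * n ^ (k - 3)"
proof -
  have "stray u = {c \<in> through u. v \<notin> Domain c \<and> Domain c \<inter> {} = {}} \<union>
      {c \<in> through u. v \<in> Domain c \<and> Domain c \<inter> set Q \<noteq> {}}"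
    by (auto simp: stray_def)
  then have "card (stray u) \<le> card {c \<in> through u. v \<notin> Domain c \<and> Domain c \<inter> {} = {}} +
      card {c \<in> through u. v \<in> Domain c \<and> Domain c \<inter> set Q \<noteq> {}}"
    by (simp only: card_Un_le)
  also have "\<dots> \<le> 4 * k ^ 4 * n ^ (k - 3) + 2 * k ^ 4 * n ^ (k - 3)"
    by (intro add_mono card_cycles_avoiding_hub[OF assms] card_cycles_hitting_Q
        flexible_vertex(2,3)[OF assms])
  finally show ?thesis by (simp flip: distrib_right)
qed

text \<open>A cycle through \<open>u\<close> missing \<open>v\<close> either misses
  \<open>z\<close>, where flexibility of \<open>u\<close> relative to \<open>{z}\<close> is enough,
  or contains \<open>z\<close> and is counted there. With the cycles meeting \<open>Q\<close> the
  constants are \<open>4 + 4 + 2 = 10\<close>.\<close>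

lemma card_stray_via:
  assumes z: "flexible z j {}" "0 < j" "j < k" and u: "flexible u i {z}" "0 < i" "i < k"
  shows "card (stray u) \<le> 10 * k ^ 4 * n ^ (k - 3)"
proof -
  let ?S1 = "{c \<in> through u. v \<notin> Domain c \<and> Domain c \<inter> {z} = {}}"
  let ?S2 = "{c \<in> through z. v \<notin> Domain c \<and> Domain c \<inter> {} = {}}"
  let ?S3 = "{c \<in> through u. v \<in> Domain c \<and> Domain c \<inter> set Q \<noteq> {}}"
  have "stray u \<subseteq> ?S1 \<union> ?S2 \<union> ?S3" by (auto simp: stray_def through_def)
  then have "card (stray u) \<le> card (?S1 \<union> ?S2 \<union> ?S3)"
    by (rule card_mono[rotated]) (simp add: finite_through)
  also have "\<dots> \<le> card ?S1 + card ?S2 + card ?S3"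
    by (meson add_mono card_Un_le order_refl order_trans)
  also have "\<dots> \<le> 4 * k ^ 4 * n ^ (k - 3) + 4 * k ^ 4 * n ^ (k - 3) + 2 * k ^ 4 * n ^ (k - 3)"
    by (intro add_mono card_cycles_avoiding_hub[OF u] card_cycles_avoiding_hub[OF z]
        card_cycles_hitting_Q flexible_vertex(2,3)[OF u])
  finally show ?thesis by (simp flip: distrib_right)
qed

text \<open>A set \<open>S\<close> of at most \<open>k\<close> vertices blocks every hub cycle with
  \<open>u\<close> at position \<open>i\<close>. It avoids all prescribed values, so it is hit
  outside \<open>I\<close>, which saves a further factor \<open>n\<close>. The general
  \<open>I\<close> serves both \<open>{0, i}\<close> and \<open>{0, 1, k - 1}\<close>.\<close>

lemma card_inflexible:
  assumes "\<not> flexible u i Z" "0 < i" "i < k" "I \<subseteq> {..<k}" "{0, i} \<subseteq> I"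
    and "\<And>j. j \<in> I - {0, i} \<Longrightarrow> f j \<in> Z" "f 0 = v" "f i = u"
  shows "card {xs \<in> hub_cycles. \<forall>j\<in>I. xs ! j = f j} \<le> (k - card I) * k * n ^ (k - Suc (card I))"
proof -
  obtain S where S: "finite S" "card S \<le> k" "S \<inter> insert u (insert v Z) = {}"
    "\<And>xs. xs \<in> hub_cycles \<Longrightarrow> xs ! i = u \<Longrightarrow> set xs \<inter> S \<noteq> {}"
    using assms(1) unfolding flexible_def by blast
  have "{xs \<in> hub_cycles. \<forall>j\<in>I. xs ! j = f j} \<subseteq>
      {xs \<in> fixed_lists V k I f. \<exists>a<k. a \<notin> I \<and> xs ! a \<in> S}"
  proof
    fix xs assume xs: "xs \<in> {xs \<in> hub_cycles. \<forall>j\<in>I. xs ! j = f j}"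
    then have "xs ! i = u" using assms(5,8) by auto
    then obtain a where a: "a < length xs" "xs ! a \<in> S"
      using S(4)[of xs] xs by (auto simp: in_set_conv_nth disjoint_iff)
    moreover have "a \<notin> I"
    proof
      assume "a \<in> I"
      then have "f a \<in> insert u (insert v Z)"
        using assms(6)[of a] assms(7,8) by (cases "a = 0"; cases "a = i") auto
      moreover have "f a \<in> S" using xs \<open>a \<in> I\<close> a(2) by auto
      ultimately show False using S(3) by blast
    qed
    ultimately show "xs \<in> {xs \<in> fixed_lists V k I f. \<exists>a<k. a \<notin> I \<and> xs ! a \<in> S}"
      using xs by (auto simp: hub_cycles_def intro!: dcycle_fixed)
  qed
  then have "card {xs \<in> hub_cycles. \<forall>j\<in>I. xs ! j = f j} \<le>
      card {xs \<in> fixed_lists V k I f. \<exists>a<k. a \<notin> I \<and> xs ! a \<in> S}"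
    by (rule card_mono[rotated]) (simp add: finite_fixed_lists finV)
  also have "\<dots> \<le> (k - card I) * card S * n ^ (k - Suc (card I))"
    by (rule card_fixed_lists_hit[OF finV S(1) assms(4)])
  also have "\<dots> \<le> (k - card I) * k * n ^ (k - Suc (card I))"
    using S(2) by (intro mult_mono) auto
  finally show ?thesis .
qed

lemma layer_flexible:
  assumes "u \<in> layer i" "0 < i" "i < k"
  shows "flexible u i {}"
proof (rule ccontr)
  assume "\<not> flexible u i {}"
  then have "card {xs \<in> hub_cycles. \<forall>j\<in>{0, i}. xs ! j = (if j = 0 then v else u)}
      \<le> (k - card {0, i}) * k * n ^ (k - Suc (card {0, i}))"
    using assms by (intro card_inflexible[of u i "{}"]) auto
  moreover have "{xs \<in> hub_cycles. \<forall>j\<in>{0, i}. xs ! j = (if j = 0 then v else u)} = hub_cycles_at i u"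
    using assms(2) by (auto simp: hub_cycles_at_def hub_cycles_def)
  moreover have "card {0, i} = 2" using assms(2) by auto
  ultimately have "card (hub_cycles_at i u) \<le> (k - 2) * k * n ^ (k - 3)" by (simp add: numeral_3_eq_3)
  also have "\<dots> \<le> k * k * n ^ (k - 3)" by (intro mult_right_mono) auto
  finally show False using assms(1) by (simp add: layer_def)
qed

text \<open>Go from \<open>v\<close> to \<open>a\<close> along a hub cycle with \<open>a\<close> at
  the later position \<open>j\<close>, and return along one with \<open>a\<close> at position
  \<open>i\<close> that shares only \<open>a\<close> and \<open>v\<close> with the first. The
  spliced cycle has length \<open>k + j - i\<close>, against \<open>circ\<close>.\<close>

lemma layer_disjoint:
  assumes "a \<in> layer i" "a \<in> layer j" "0 < i" "i < j" "j < k"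
  shows False
proof -
  have fi: "flexible a i {}" "flexible a j {}" using layer_flexible assms by auto
  obtain xs where xs: "xs \<in> hub_cycles" "xs ! j = a"
    using flexibleE[OF fi(2), of "{}"] by auto
  have xsp: "dcycle E xs" "length xs = k" "xs ! 0 = v" using xs(1) by (auto simp: hub_cycles_def)
  have "card (set xs - {a, v}) \<le> card (set xs)" by (rule card_mono) auto
  then have "card (set xs - {a, v}) \<le> k" using card_length[of xs] xsp(2) by simp
  then obtain ys where ys: "ys \<in> hub_cycles" "ys ! i = a" "set ys \<inter> (set xs - {a, v}) = {}"
    using flexibleE[OF fi(1), of "set xs - {a, v}"] by auto
  have ysp: "dcycle E ys" "length ys = k" "ys ! 0 = v" using ys(1) by (auto simp: hub_cycles_def)
  let ?T = "take j xs" and ?D = "drop (Suc i) ys"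
  have sx: "xs = ?T @ a # drop (Suc j) xs" using id_take_nth_drop[of j xs] xs(2) xsp(2) assms by simp
  have sy: "ys = take i ys @ a # ?D" using id_take_nth_drop[of i ys] ys(2) ysp(2) assms by simp
  have ne: "?T \<noteq> []" "take i ys \<noteq> []" using xsp(2) ysp(2) assms by auto
  have hdT: "hd ?T = v" "hd (take i ys) = v" using xsp(2,3) ysp(2,3) ne by (simp_all add: hd_conv_nth)
  have p1: "dpath E (?T @ [a])" and px: "dpath E (?T @ a # drop (Suc j) xs)"
    using xsp(1) sx by (metis dcycle_iff dpath_Cons_append)+
  have p2: "dpath E (a # ?D)" and py: "dpath E (take i ys @ a # ?D)"
    using ysp(1) sy by (metis dcycle_iff dpath_Cons_append)+
  have "v \<in> set (take i ys)" using hdT ne by (metis hd_in_set)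
  then have vD: "v \<notin> set ?D" "a \<notin> set ?D" using py by (auto simp: dpath_append dpath_Cons)
  have "set ?D \<subseteq> set ys" "set ?T \<subseteq> set xs" by (auto dest: in_set_dropD in_set_takeD)
  then have "set ?T \<inter> set ?D = {}" using ys(3) vD by blast
  then have "dpath E (?T @ a # ?D)" using p1 p2 by (subst dpath_Cons_append) auto
  moreover have "(last (?T @ a # ?D), hd (?T @ a # ?D)) \<in> E"
  proof -
    have "(last ys, hd ys) \<in> E" using ysp(1) by (simp add: dcycle_iff)
    moreover have "last ys = last (a # ?D)" by (subst sy) simp
    moreover have "hd ys = v" using hdT ne by (subst sy) simp
    ultimately show ?thesis using hdT(1) ne(1) by simp
  qed
  ultimately have "dcycle E (?T @ a # ?D)" by (simp add: dcycle_iff)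
  from circ[OF this] show False using xsp(2) ysp(2) assms by simp
qed

end

section \<open>The inequality of the means and the cycles meeting the layers\<close>

lemma prod_le_power_mean:
  fixes x :: "'a \<Rightarrow> real"
  assumes "finite I" "I \<noteq> {}" "\<And>i. i \<in> I \<Longrightarrow> 0 \<le> x i"
  shows "(\<Prod>i\<in>I. x i) \<le> ((\<Sum>i\<in>I. x i) / card I) ^ card I"
proof -
  let ?p = "\<Prod>i\<in>I. x i"
  have c: "card I \<noteq> 0" using assms by simp
  have p: "0 \<le> ?p" using assms(3) by (rule prod_nonneg)
  have "?p = (?p powr (1 / card I)) ^ card I"
    using c p by (cases "?p = 0") (simp_all add: powr_power)
  also have "\<dots> \<le> (\<Sum>i\<in>I. x i / card I) ^ card I"
    using arith_geom_mean[OF assms] by (intro power_mono) auto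
  finally show ?thesis by (simp add: sum_divide_distrib)
qed

context hub
begin

text \<open>This is the set \<open>W\<close> of the overview.\<close>

definition block :: "'a set" where
  "block = (\<Union>i\<in>{1..<k}. layer i)"

lemma block_subset: "block \<subseteq> V"
  by (auto simp: block_def layer_def)

lemma finite_layer: "finite (layer i)"
  using finV by (simp add: layer_def)

lemma n_power: "n * n ^ (k - 3) = n ^ (k - 2)"
proof -
  have "k - 2 = Suc (k - 3)" using k3 by simp
  then show ?thesis by simp
qed

lemma not_stray_obtain:
  assumes "c \<in> through u - stray u"
  obtains xs where "xs \<in> hub_cycles" "c = arcset xs"
proof -
  have c: "c \<in> cycles E k" "v \<in> Domain c" "Domain c \<inter> set Q = {}"
    using assms by (auto simp: through_def stray_def)
  then obtain xs where "dcycle E xs" "length xs = k" "c = arcset xs" "xs ! 0 = v"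
    using cycles_obtain_nth[of c E k v 0] k3 by auto
  then show ?thesis using that[of xs] c by (simp add: hub_cycles_def Domain_arcset)
qed

text \<open>Outside all layers, the positions from \<open>1\<close> to \<open>k - 1\<close>
  contribute at most \<open>k ^ 4 * n ^ (k - 3)\<close> hub cycles; with the stray cycles this
  explains \<open>11 = 10 + 1\<close>.\<close>

lemma rich_in_block:
  assumes u: "u \<in> V" "u \<noteq> v" and rich: "11 * k ^ 4 * n ^ (k - 3) < card (through u)"
    and stray: "card (stray u) \<le> 10 * k ^ 4 * n ^ (k - 3)"
  shows "u \<in> block"
proof (rule ccontr)
  assume "u \<notin> block"
  then have small: "card (hub_cycles_at i u) \<le> k * k * n ^ (k - 3)" if "i \<in> {1..<k}" for i
    using u(1) that by (auto simp: block_def layer_def not_less)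
  have sub: "through u - stray u \<subseteq> arcset ` (\<Union>i\<in>{1..<k}. hub_cycles_at i u)"
  proof
    fix c assume c: "c \<in> through u - stray u"
    then obtain xs where xs: "xs \<in> hub_cycles" "c = arcset xs" by (rule not_stray_obtain)
    then have len: "length xs = k" "xs ! 0 = v" by (auto simp: hub_cycles_def)
    have "u \<in> set xs" using c xs(2) by (auto simp: through_def Domain_arcset)
    then obtain i where i: "i < k" "xs ! i = u" using len by (auto simp: in_set_conv_nth)
    then have "i \<noteq> 0" using u(2) len(2) by metis
    then have "i \<in> {1..<k}" "xs \<in> hub_cycles_at i u" using xs(1) i by (auto simp: hub_cycles_at_def)
    then show "c \<in> arcset ` (\<Union>i\<in>{1..<k}. hub_cycles_at i u)" using xs(2) by blast
  qed
  have "card (through u) \<le> card (stray u \<union> (through u - stray u))"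
    by (rule card_mono) (auto simp: stray_def finite_through)
  also have "\<dots> \<le> card (stray u) + card (through u - stray u)" by (rule card_Un_le)
  also have "card (through u - stray u) \<le> card (\<Union>i\<in>{1..<k}. hub_cycles_at i u)"
    using sub by (rule surj_card_le[rotated]) (simp add: finite_hub_cycles_at)
  also have "\<dots> \<le> card {1..<k} * (k * k * n ^ (k - 3))"
    by (rule card_UN_bound) (use small in auto)
  also have "\<dots> \<le> (k * k) * (k * k * n ^ (k - 3))"
  proof (rule mult_right_mono)
    have "k \<le> k * k" by (cases k) auto
    then show "card {1..<k} \<le> k * k" unfolding card_atLeastLessThan by linarith
  qed simp
  also have "\<dots> = k ^ 4 * n ^ (k - 3)" by (simp add: power4_eq_xxxx mult_ac)
  finally have "card (through u) \<le> card (stray u) + k ^ 4 * n ^ (k - 3)" by simp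
  then show False using rich stray by simp
qed

lemma card_hub_cycles_in_layers:
  "card {xs \<in> hub_cycles. \<forall>i\<in>{1..<k}. xs ! i \<in> layer i} \<le> (\<Prod>i\<in>{1..<k}. card (layer i))"
proof -
  let ?F = "{xs \<in> hub_cycles. \<forall>i\<in>{1..<k}. xs ! i \<in> layer i}"
  have "card ?F \<le> card (PiE {1..<k} layer)"
  proof (rule card_inj_on_le)
    show "inj_on (\<lambda>xs. restrict (nth xs) {1..<k}) ?F"
    proof (rule inj_onI)
      fix xs ys
      assume *: "xs \<in> ?F" "ys \<in> ?F" "restrict (nth xs) {1..<k} = restrict (nth ys) {1..<k}"
      show "xs = ys"
      proof (rule nth_equalityI)
        show "length xs = length ys" using * by (simp add: hub_cycles_def)
        fix i assume "i < length xs"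
        then have "i < k" using *(1) by (simp add: hub_cycles_def)
        then show "xs ! i = ys ! i"
          using *(1,2) fun_cong[OF *(3), of i] by (cases "i = 0") (simp_all add: hub_cycles_def)
      qed
    qed
    show "(\<lambda>xs. restrict (nth xs) {1..<k}) ` ?F \<subseteq> PiE {1..<k} layer"
      by (intro image_subsetI restrict_PiE_iff[THEN iffD2]) auto
    show "finite (PiE {1..<k} layer)" by (intro finite_PiE finite_layer) auto
  qed
  then show ?thesis by (simp add: card_PiE)
qed

text \<open>Such a cycle is stray at a vertex of the block, or has an entry outside the layer of its
  position, or has every entry in its layer. The first two kinds cost a choice of a vertex and then
  order \<open>n ^ (k - 3)\<close>, with constants \<open>6 + 1 = 7\<close>; the third gives the
  product.\<close>

lemma card_cycles_meeting_block:
  "card {c \<in> cycles E k. Domain c \<inter> block \<noteq> {}} \<le>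
     (\<Prod>i\<in>{1..<k}. card (layer i)) + 7 * k ^ 4 * n ^ (k - 2)"
proof -
  let ?F = "{xs \<in> hub_cycles. \<forall>i\<in>{1..<k}. xs ! i \<in> layer i}"
  let ?G = "\<Union>i\<in>{1..<k}. \<Union>u\<in>V - layer i. hub_cycles_at i u"
  have fin: "finite ?F" "finite ?G" "finite block"
    using finite_hub_cycles finite_hub_cycles_at finV finite_subset[OF block_subset] by auto
  have "{c \<in> cycles E k. Domain c \<inter> block \<noteq> {}} \<subseteq> (\<Union>a\<in>block. stray a) \<union> arcset ` (?F \<union> ?G)"
  proof
    fix c assume c: "c \<in> {c \<in> cycles E k. Domain c \<inter> block \<noteq> {}}"
    then obtain a where a: "a \<in> block" "c \<in> through a" by (auto simp: through_def)
    show "c \<in> (\<Union>a\<in>block. stray a) \<union> arcset ` (?F \<union> ?G)"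
    proof (cases "c \<in> stray a")
      case False
      then obtain xs where xs: "xs \<in> hub_cycles" "c = arcset xs" using a not_stray_obtain by blast
      have "xs \<in> ?F \<union> ?G"
      proof (rule ccontr)
        assume *: "xs \<notin> ?F \<union> ?G"
        then obtain i where i: "i \<in> {1..<k}" "xs ! i \<notin> layer i" using xs(1) by blast
        then have "xs ! i \<in> V - layer i" using hub_cycles_nth(1)[OF xs(1), of i] by auto
        moreover have "xs \<in> hub_cycles_at i (xs ! i)" using xs(1) by (simp add: hub_cycles_at_def)
        ultimately show False using * i(1) by blast
      qed
      then show ?thesis using xs(2) by blast
    qed (use a in blast)
  qed
  then have "card {c \<in> cycles E k. Domain c \<inter> block \<noteq> {}} \<le>
      card ((\<Union>a\<in>block. stray a) \<union> arcset ` (?F \<union> ?G))"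
    by (rule card_mono[rotated]) (use fin finite_through in \<open>auto simp: stray_def\<close>)
  also have "\<dots> \<le> card (\<Union>a\<in>block. stray a) + card (arcset ` (?F \<union> ?G))" by (rule card_Un_le)
  also have "\<dots> \<le> card (\<Union>a\<in>block. stray a) + (card ?F + card ?G)"
    using card_image_le[of "?F \<union> ?G" arcset] card_Un_le[of ?F ?G] fin by simp
  also have "card (\<Union>a\<in>block. stray a) \<le> n * (6 * k ^ 4 * n ^ (k - 3))"
  proof -
    have "card (\<Union>a\<in>block. stray a) \<le> card block * (6 * k ^ 4 * n ^ (k - 3))"
    proof (rule card_UN_bound)
      fix a assume "a \<in> block"
      then obtain i where "a \<in> layer i" "0 < i" "i < k" by (auto simp: block_def)
      then show "card (stray a) \<le> 6 * k ^ 4 * n ^ (k - 3)"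
        using card_stray layer_flexible by blast
    qed (rule fin)
    also have "\<dots> \<le> n * (6 * k ^ 4 * n ^ (k - 3))"
      using card_mono[OF finV block_subset] by (rule mult_right_mono) simp
    finally show ?thesis .
  qed
  also have "card ?G \<le> card {1..<k} * (n * (k * k * n ^ (k - 3)))"
  proof (rule card_UN_bound)
    fix i
    have "card (\<Union>u\<in>V - layer i. hub_cycles_at i u) \<le> card (V - layer i) * (k * k * n ^ (k - 3))"
      by (rule card_UN_bound) (use finV in \<open>auto simp: layer_def not_less\<close>)
    also have "\<dots> \<le> n * (k * k * n ^ (k - 3))"
      using card_mono[OF finV, of "V - layer i"] by (intro mult_right_mono) auto
    finally show "card (\<Union>u\<in>V - layer i. hub_cycles_at i u) \<le> n * (k * k * n ^ (k - 3))" .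
  qed simp
  also have "\<dots> \<le> (k * k) * (n * (k * k * n ^ (k - 3)))"
  proof (rule mult_right_mono)
    have "k \<le> k * k" by (cases k) auto
    then show "card {1..<k} \<le> k * k" unfolding card_atLeastLessThan by linarith
  qed simp
  also note card_hub_cycles_in_layers
  also have "n * (6 * k ^ 4 * n ^ (k - 3)) + ((\<Prod>i\<in>{1..<k}. card (layer i)) +
      (k * k) * (n * (k * k * n ^ (k - 3)))) = (\<Prod>i\<in>{1..<k}. card (layer i)) + 7 * k ^ 4 * n ^ (k - 2)"
    unfolding n_power[symmetric] by (simp add: power4_eq_xxxx)
  finally show ?thesis by simp
qed

lemma card_block: "card block = (\<Sum>i\<in>{1..<k}. card (layer i))"
  unfolding block_def
proof (rule card_UN_disjoint)
  show "\<forall>i\<in>{1..<k}. \<forall>j\<in>{1..<k}. i \<noteq> j \<longrightarrow> layer i \<inter> layer j = {}"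
  proof (intro ballI impI)
    fix i j assume "i \<in> {1..<k}" "j \<in> {1..<k}" "i \<noteq> j"
    then show "layer i \<inter> layer j = {}"
      using layer_disjoint[of _ i j] layer_disjoint[of _ j i] by (cases i j rule: linorder_cases) auto
  qed
qed (simp_all add: finite_layer)

lemma real_card_cycles_meeting_block:
  "real (card {c \<in> cycles E k. Domain c \<inter> block \<noteq> {}}) \<le>
     (real (card block) / (real k - 1)) ^ (k - 1) + 7 * real k ^ 4 * real n ^ (k - 2)"
proof -
  have "real (card {c \<in> cycles E k. Domain c \<inter> block \<noteq> {}}) \<le>
      real ((\<Prod>i\<in>{1..<k}. card (layer i)) + 7 * k ^ 4 * n ^ (k - 2))"
    using card_cycles_meeting_block of_nat_le_iff by blast
  also have "\<dots> = (\<Prod>i\<in>{1..<k}. real (card (layer i))) + 7 * real k ^ 4 * real n ^ (k - 2)"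
    by simp
  also have "(\<Prod>i\<in>{1..<k}. real (card (layer i))) \<le>
      ((\<Sum>i\<in>{1..<k}. real (card (layer i))) / card {1..<k}) ^ card {1..<k}"
    using k3 by (intro prod_le_power_mean) auto
  also have "\<dots> = (real (card block) / (real k - 1)) ^ (k - 1)"
    using k3 by (simp add: card_block of_nat_diff)
  finally show ?thesis by simp
qed

text \<open>Consider the vertex \<open>u\<close> after the hub. If it is flexible relative to
  \<open>{z}\<close>, it lies in the block by \<open>rich\<close>, and three entries are fixed. If
  not, there are up to \<open>n\<close> choices for \<open>u\<close>, but
  \<open>card_inflexible\<close> restricts a fourth entry.\<close>

lemma card_cycles_at_end_le_block:
  assumes z: "flexible z (k - 1) {}"
    and rich: "\<And>u. u \<in> V \<Longrightarrow> 11 * k ^ 4 * n ^ (k - 3) < card (through u)"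
  shows "card (hub_cycles_at (k - 1) z) \<le> (card block + k\<^sup>2) * n ^ (k - 3)"
proof -
  let ?I = "{0, 1, k - 1}"
  let ?f = "\<lambda>u i. if i = 0 then v else if i = 1 then u else z"
  let ?S = "\<lambda>u. {xs \<in> hub_cycles. \<forall>j\<in>?I. xs ! j = ?f u j}"
  let ?N = "{u \<in> V. \<not> flexible u 1 {z}}"
  have three: "card ?I = 3" using k3 by auto
  have "hub_cycles_at (k - 1) z \<subseteq> (\<Union>u\<in>block. ?S u) \<union> (\<Union>u\<in>?N. ?S u)"
  proof
    fix xs assume "xs \<in> hub_cycles_at (k - 1) z"
    then have xs: "xs \<in> hub_cycles" "xs ! (k - 1) = z" by (auto simp: hub_cycles_at_def)
    let ?u = "xs ! 1"
    have u: "?u \<in> V" "?u \<noteq> v" using hub_cycles_nth[OF xs(1), of 1] k3 by auto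
    have S: "xs \<in> ?S ?u" using xs k3 by (auto simp: hub_cycles_def)
    show "xs \<in> (\<Union>u\<in>block. ?S u) \<union> (\<Union>u\<in>?N. ?S u)"
    proof (cases "flexible ?u 1 {z}")
      case True
      then have "card (stray ?u) \<le> 10 * k ^ 4 * n ^ (k - 3)"
        using card_stray_via[OF z] k3 by simp
      then have "?u \<in> block" using rich_in_block u rich by blast
      then show ?thesis using S by blast
    next
      case False
      then show ?thesis using S u(1) by blast
    qed
  qed
  moreover have fin: "finite block" using finite_subset[OF block_subset finV] .
  moreover have finS: "finite (?S u)" for u using finite_hub_cycles by simp
  ultimately have "card (hub_cycles_at (k - 1) z) \<le> card ((\<Union>u\<in>block. ?S u) \<union> (\<Union>u\<in>?N. ?S u))"
    using finV by (intro card_mono) auto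
  also have "\<dots> \<le> card (\<Union>u\<in>block. ?S u) + card (\<Union>u\<in>?N. ?S u)" by (rule card_Un_le)
  also have "card (\<Union>u\<in>block. ?S u) \<le> card block * n ^ (k - 3)"
  proof (rule card_UN_bound[OF fin])
    fix u
    have "?S u \<subseteq> fixed_lists V k ?I (?f u)"
    proof
      fix xs assume "xs \<in> ?S u"
      then have "dcycle E xs" "length xs = k" "\<forall>j\<in>?I. xs ! j = ?f u j"
        unfolding hub_cycles_def by blast+
      then show "xs \<in> fixed_lists V k ?I (?f u)"
        by (intro dcycle_fixed) blast+
    qed
    then have "card (?S u) \<le> card (fixed_lists V k ?I (?f u))"
      by (intro card_mono finite_fixed_lists finV)
    also have "\<dots> \<le> n ^ (k - card ?I)" using k3 by (intro card_fixed_lists finV) auto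
    finally show "card (?S u) \<le> n ^ (k - 3)" unfolding three .
  qed
  also have "card (\<Union>u\<in>?N. ?S u) \<le> n * ((k - 3) * k * n ^ (k - 4))"
  proof -
    have "card (\<Union>u\<in>?N. ?S u) \<le> card ?N * ((k - 3) * k * n ^ (k - 4))"
    proof (rule card_UN_bound)
      fix u assume u: "u \<in> ?N"
      have "card (?S u) \<le> (k - card ?I) * k * n ^ (k - Suc (card ?I))"
        using u k3 by (intro card_inflexible[of u 1 "{z}"]) auto
      also have "\<dots> = (k - 3) * k * n ^ (k - 4)" unfolding three by (simp add: eval_nat_numeral)
      finally show "card (?S u) \<le> (k - 3) * k * n ^ (k - 4)" .
    qed (use finV in simp)
    also have "\<dots> \<le> n * ((k - 3) * k * n ^ (k - 4))"
      using card_mono[OF finV, of ?N] by (intro mult_right_mono) auto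
    finally show ?thesis .
  qed
  also have "n * ((k - 3) * k * n ^ (k - 4)) \<le> k\<^sup>2 * n ^ (k - 3)"
  \<comment> \<open>\<open>k - 4\<close> truncates when \<open>k = 3\<close>, but then the factor
    \<open>k - 3\<close> vanishes.\<close>
  proof (cases "k = 3")
    case False
    then have "k - 3 = Suc (k - 4)" using k3 by simp
    then have "n * ((k - 3) * k * n ^ (k - 4)) = ((k - 3) * k) * n ^ (k - 3)" by simp
    also have "\<dots> \<le> k\<^sup>2 * n ^ (k - 3)"
      unfolding power2_eq_square by (intro mult_right_mono) auto
    finally show ?thesis .
  qed simp
  finally show ?thesis by (simp add: distrib_right)
qed

end

section \<open>A set whose deletion destroys few cycles\<close>

context bounded_circumference
begin

text \<open>The hub is the \<open>k\<close>-th vertex from the end of a longest path. The end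
  \<open>z\<close> is returned along with \<open>W\<close> because its many cycles force
  \<open>W\<close> to be large.\<close>

lemma removable_set:
  assumes k: "3 \<le> k" and ne: "V \<noteq> {}"
    and rich: "\<And>u. u \<in> V \<Longrightarrow> 11 * k ^ 4 * card V ^ (k - 3) < card (through u)"
  obtains W z where "W \<subseteq> V" "z \<in> V"
    "card (through z) \<le> (card W + 2 * k ^ 4) * card V ^ (k - 3)"
    "real (card {c \<in> cycles E k. Domain c \<inter> W \<noteq> {}}) \<le>
     (real (card W) / (real k - 1)) ^ (k - 1) + 7 * real k ^ 4 * real (card V) ^ (k - 2)"
proof -
  obtain P where P: "dpath E P" "set P \<subseteq> V" "P \<noteq> []"
    and longest: "\<And>R. dpath E R \<Longrightarrow> set R \<subseteq> V \<Longrightarrow> length R \<le> length P"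
    using longest_path_exists[OF finV ne] by metis
  let ?z = "last P" and ?Q = "take (length P - k) P" and ?v = "P ! (length P - k)"
  let ?G = "{xs. dcycle E xs \<and> length xs = k \<and> k \<le> length P \<and>
       xs ! 0 = ?v \<and> xs ! (k - 1) = ?z \<and> set xs \<inter> set ?Q = {}}"
  have G: "card (through ?z) \<le> card ?G + k ^ 4 * card V ^ (k - 3)"
    by (rule cycles_at_end_of_longest_path[OF P longest k])
  have z: "?z \<in> V" using P by auto
  \<comment> \<open>One of the \<open>11\<close> units in \<open>rich\<close> is lost to the error
    in \<open>G\<close>. The rest makes \<open>?G\<close> nonempty, so that \<open>P\<close> has at
    least \<open>k\<close> vertices, and later puts \<open>?z\<close> into
    \<open>layer (k - 1)\<close>.\<close>
  have big: "10 * k ^ 4 * card V ^ (k - 3) < card ?G" using G rich[OF z] by simp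
  then have "?G \<noteq> {}" by (metis card.empty not_less0)
  then have len: "k \<le> length P" by blast
  have Qv: "?Q @ [?v] = take (Suc (length P - k)) P"
    using len k by (simp add: take_Suc_conv_app_nth)
  interpret hub V E k ?Q ?v
  proof unfold_locales
    have "dpath E (take (Suc (length P - k)) P @ drop (Suc (length P - k)) P)" using P(1) by simp
    then show "dpath E (?Q @ [?v])" unfolding Qv dpath_append by blast
    show "set (?Q @ [?v]) \<subseteq> V" unfolding Qv using P(2) by (meson order_trans set_take_subset)
    show "length R \<le> length ?Q + k" if "dpath E R" "set R \<subseteq> V" for R
      using longest[OF that] len by simp
    show "3 \<le> k" by fact
  qed
  have "?G \<subseteq> hub_cycles_at (k - 1) ?z" by (auto simp: hub_cycles_at_def hub_cycles_def)
  then have GX: "card ?G \<le> card (hub_cycles_at (k - 1) ?z)" by (rule card_mono[OF finite_hub_cycles_at])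
  have "k * k * card V ^ (k - 3) \<le> 10 * k ^ 4 * card V ^ (k - 3)"
    by (intro mult_right_mono) (auto simp: power4_eq_xxxx)
  then have "k * k * card V ^ (k - 3) < card (hub_cycles_at (k - 1) ?z)" using big GX by linarith
  then have "?z \<in> layer (k - 1)" using z by (simp add: layer_def)
  then have "flexible ?z (k - 1) {}" using k by (intro layer_flexible) auto
  then have "card (hub_cycles_at (k - 1) ?z) \<le> (card block + k\<^sup>2) * card V ^ (k - 3)"
    using rich by (rule card_cycles_at_end_le_block)
  then have "card (through ?z) \<le> (card block + k\<^sup>2) * card V ^ (k - 3) + k ^ 4 * card V ^ (k - 3)"
    using G GX by linarith
  also have "\<dots> = (card block + (k\<^sup>2 + k ^ 4)) * card V ^ (k - 3)" by (simp add: algebra_simps)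
  also have "\<dots> \<le> (card block + 2 * k ^ 4) * card V ^ (k - 3)"
  proof (intro mult_right_mono add_left_mono)
    have "k\<^sup>2 \<le> k ^ 4" using k by (intro power_increasing) auto
    then show "k\<^sup>2 + k ^ 4 \<le> 2 * k ^ 4" by simp
  qed simp
  finally show ?thesis
    using that[of block ?z] block_subset z real_card_cycles_meeting_block by blast
qed

end

subsection \<open>The upper bound\<close>

text \<open>Superadditivity merges the leading terms of a deleted part and of the remainder.\<close>

lemma power_add_le_add_power:
  fixes x y :: real
  assumes "0 \<le> x" "0 \<le> y" "0 < m"
  shows "x ^ m + y ^ m \<le> (x + y) ^ m"
  using assms(3)
proof (induction m rule: nat_induct_non_zero)
  case (Suc m)
  have "x ^ Suc m + y ^ Suc m \<le> (x + y) * (x ^ m + y ^ m)"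
    using assms(1,2) by (simp add: algebra_simps)
  also have "\<dots> \<le> (x + y) * (x + y) ^ m"
    using Suc assms by (intro mult_left_mono) auto
  finally show ?case by simp
qed simp

text \<open>A mean value estimate; in the final theorem it absorbs the replacement of
  \<open>n\<close> by \<open>n - 1\<close> and the rounding of layer sizes.\<close>

lemma power_diff_le:
  fixes x y :: real
  assumes "0 \<le> y" "y \<le> x"
  shows "x ^ Suc m - y ^ Suc m \<le> Suc m * (x - y) * x ^ m"
proof (induction m)
  case (Suc m)
  have "x ^ Suc (Suc m) - y ^ Suc (Suc m) = x * (x ^ Suc m - y ^ Suc m) + (x - y) * y ^ Suc m"
    by (simp add: algebra_simps)
  also have "\<dots> \<le> x * (Suc m * (x - y) * x ^ m) + (x - y) * x ^ Suc m"
    using assms Suc by (intro add_mono mult_left_mono power_mono) auto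
  also have "\<dots> = Suc (Suc m) * (x - y) * x ^ Suc m" by (simp add: algebra_simps)
  finally show ?case .
qed simp

lemma card_cycles_trivial:
  assumes "finite V" "E \<subseteq> V \<times> V"
  shows "card (cycles E l) \<le> card V ^ l"
proof -
  have "card (cycles E l) \<le> card {xs. set xs \<subseteq> V \<and> length xs = l}"
    unfolding cycles_def
    by (rule surj_card_le[OF finite_lists_length_eq[OF assms(1)]])
       (use dcycle_subset[OF _ assms(2)] in blast)
  then show ?thesis by (simp add: card_lists_length_eq assms(1))
qed

lemma card_cycles_upper:
  fixes k :: nat
  assumes k: "3 \<le> k"
  obtains D :: real where "0 \<le> D"
    "\<And>(V :: 'a set) E. bounded_circumference V E k \<Longrightarrow>
       real (card (cycles E k)) \<le> (real (card V) / (real k - 1)) ^ (k - 1) + D * real (card V) ^ (k - 2)"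
proof -
  define p where "p = real k - 1"
  \<comment> \<open>The coefficient of the leading term; \<open>c * n ^ (k - 2)\<close> is also the
    threshold below which a single vertex is deleted.\<close>
  define c where "c = 1 / p ^ (k - 1)"
  \<comment> \<open>If \<open>n * c\<close> is at least \<open>M\<close>, vertices above the
    threshold for \<open>c\<close> satisfy the hypothesis \<open>rich\<close> of
    \<open>removable_set\<close>.\<close>
  define M where "M = 12 * real k ^ 4"
  \<comment> \<open>The first summand handles digraphs with \<open>n * c < M\<close>, the second
    pays for the error \<open>7 * k ^ 4 * n ^ (k - 2)\<close> when \<open>W\<close> is
    deleted.\<close>
  define D where "D = (M / c)\<^sup>2 + 14 * real k ^ 4 / c"
  have p: "0 < p" using k by (simp add: p_def)
  have c: "0 < c" using p by (simp add: c_def)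
  have D: "0 \<le> D" using c by (simp add: D_def)
  have k1: "k - 1 = Suc (k - 2)" "k - 2 = Suc (k - 3)" using k by auto
  have "real (card (cycles E k)) \<le> (real (card V) / p) ^ (k - 1) + D * real (card V) ^ (k - 2)"
    if "bounded_circumference V E k" for V :: "'a set" and E
    using that
  proof (induction "card V" arbitrary: V E rule: less_induct)
    case less
    interpret bounded_circumference V E k by fact
    let ?n = "real (card V)"
    have restrict_le: "real (card (cycles E k)) \<le>
        (real (card (V - W)) / p) ^ (k - 1) + D * real (card (V - W)) ^ (k - 2) +
        real (card {c \<in> cycles E k. Domain c \<inter> W \<noteq> {}})"
      if "card (V - W) < card V" for W
      using less.hyps[OF that restrict[of W]] card_cycles_restrict[of k W] by linarith
    consider "V = {}" | "?n * c < M" | u where "u \<in> V" "real (card (through u)) \<le> c * ?n ^ (k - 2)"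
      | "V \<noteq> {}" "M \<le> ?n * c" "\<And>u. u \<in> V \<Longrightarrow> c * ?n ^ (k - 2) < real (card (through u))"
      by (meson not_le)
    then show ?case
    proof cases
      case 1
      then have "card (cycles E k) \<le> 0"
        using card_cycles_trivial[OF finV EV, of k] k by (simp add: power_0_left)
      then show ?thesis using D p by simp
    next
      case 2
      then have n: "?n \<le> M / c" using c by (simp add: field_simps)
      have "k = 2 + (k - 2)" using k by simp
      then have "real (card (cycles E k)) \<le> ?n\<^sup>2 * ?n ^ (k - 2)"
        using card_cycles_trivial[OF finV EV, of k] by (metis of_nat_le_iff of_nat_power power_add)
      also have "\<dots> \<le> (M / c)\<^sup>2 * ?n ^ (k - 2)"
        using n by (intro mult_right_mono power_mono) auto
      also have "\<dots> \<le> D * ?n ^ (k - 2)"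
        using c by (intro mult_right_mono) (simp_all add: D_def)
      also have "\<dots> \<le> (?n / p) ^ (k - 1) + D * ?n ^ (k - 2)" using p by simp
      finally show ?thesis .
    next
      case 3
      have pos: "0 < card V" using 3(1) finV card_gt_0_iff by blast
      have card1: "real (card (V - {u})) = ?n - 1" using 3(1) finV pos by (simp add: of_nat_diff)
      have "through u = {c \<in> cycles E k. Domain c \<inter> {u} \<noteq> {}}" by (auto simp: through_def)
      then have "real (card (cycles E k)) \<le>
          ((?n - 1) / p) ^ (k - 1) + D * (?n - 1) ^ (k - 2) + c * ?n ^ (k - 2)"
        using restrict_le[of "{u}"] 3 card1 finV pos by (simp add: card_Diff1_less)
      also have "((?n - 1) / p) ^ (k - 1) = c * (?n - 1) ^ (k - 1)"
        by (simp add: c_def power_divide)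
      \<comment> \<open>One factor stays \<open>?n - 1\<close>, so the loss
        \<open>c * ?n ^ (k - 2)\<close> fits exactly into the leading term and \<open>D\<close> need
        not grow.\<close>
      also have "\<dots> \<le> c * ((?n - 1) * ?n ^ (k - 2))"
        unfolding k1(1) power_Suc using c pos by (intro mult_left_mono power_mono) auto
      also have "D * (?n - 1) ^ (k - 2) \<le> D * ?n ^ (k - 2)"
        using D pos by (intro mult_left_mono power_mono) auto
      also have "c * ((?n - 1) * ?n ^ (k - 2)) + D * ?n ^ (k - 2) + c * ?n ^ (k - 2) =
          c * ?n ^ (k - 1) + D * ?n ^ (k - 2)"
        unfolding k1(1) power_Suc by (simp add: algebra_simps)
      also have "c * ?n ^ (k - 1) = (?n / p) ^ (k - 1)" by (simp add: c_def power_divide)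
      finally show ?thesis by simp
    next
      case 4
      have npos: "0 < ?n" using 4(1) finV by (simp add: card_gt_0_iff)
      have pow: "?n ^ (k - 2) = ?n * ?n ^ (k - 3)" unfolding k1(2) by simp
      have k4: "0 \<le> real k ^ 4" by simp
      have rich: "11 * k ^ 4 * card V ^ (k - 3) < card (through u)" if "u \<in> V" for u
      proof -
        have "11 * real k ^ 4 \<le> ?n * c" using 4(2) k4 unfolding M_def by linarith
        moreover
        have "real (11 * k ^ 4 * card V ^ (k - 3)) = 11 * real k ^ 4 * ?n ^ (k - 3)" by simp
        ultimately have "real (11 * k ^ 4 * card V ^ (k - 3)) \<le> (?n * c) * ?n ^ (k - 3)"
          by (simp only: mult_right_mono zero_le_power of_nat_0_le_iff)
        also have "\<dots> = c * ?n ^ (k - 2)" by (simp add: pow)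
        also have "\<dots> < real (card (through u))" by (rule 4(3)[OF that])
        finally show ?thesis by (simp only: of_nat_less_iff)
      qed
      obtain W z where W: "W \<subseteq> V" "z \<in> V"
        and z: "card (through z) \<le> (card W + 2 * k ^ 4) * card V ^ (k - 3)"
        and meet: "real (card {c \<in> cycles E k. Domain c \<inter> W \<noteq> {}}) \<le>
           (real (card W) / p) ^ (k - 1) + 7 * real k ^ 4 * ?n ^ (k - 2)"
        unfolding p_def by (rule removable_set[OF k 4(1) rich])
      let ?a = "real (card W)"
      have a_le: "?a \<le> ?n" using card_mono[OF finV W(1)] by simp
      have "real (card (through z)) \<le> real ((card W + 2 * k ^ 4) * card V ^ (k - 3))"
        using z by (simp only: of_nat_le_iff)
      then have "real (card (through z)) \<le> (?a + 2 * real k ^ 4) * ?n ^ (k - 3)"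
        by simp
      then have "c * ?n * ?n ^ (k - 3) < (?a + 2 * real k ^ 4) * ?n ^ (k - 3)"
        using 4(3)[OF W(2)] unfolding pow by simp
      then have "c * ?n < ?a + 2 * real k ^ 4" using npos by simp
      \<comment> \<open>\<open>2 * k ^ 4\<close> is at most a sixth of \<open>c * ?n\<close>, so
        \<open>W\<close> has linear size.\<close>
      then have a: "c * ?n / 2 \<le> ?a" 
        using 4(2) k4 unfolding M_def by (simp add: mult.commute)
      then have "0 < ?a" using c npos by (meson half_gt_zero less_le_trans mult_pos_pos)
      moreover have cardW: "real (card (V - W)) = ?n - ?a"
        using W(1) finV a_le by (simp add: card_Diff_subset finite_subset of_nat_diff)
      ultimately have "card (V - W) < card V" by linarith
      from restrict_le[OF this] meet have "real (card (cycles E k)) \<le>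
          ((?n - ?a) / p) ^ (k - 1) + D * (?n - ?a) ^ (k - 2) +
          ((?a / p) ^ (k - 1) + 7 * real k ^ 4 * ?n ^ (k - 2))"
        unfolding cardW by linarith
      moreover have "((?n - ?a) / p) ^ (k - 1) + (?a / p) ^ (k - 1) \<le> (?n / p) ^ (k - 1)"
      proof -
        have "((?n - ?a) / p) ^ (k - 1) + (?a / p) ^ (k - 1) \<le> ((?n - ?a) / p + ?a / p) ^ (k - 1)"
          using a_le p k by (intro power_add_le_add_power) auto
        then show ?thesis by (simp flip: add_divide_distrib)
      qed
      \<comment> \<open>Deleting \<open>?a\<close> vertices frees
        \<open>D * ?a * ?n ^ (k - 3)\<close>, which covers the error because \<open>?a\<close> is
        linear in \<open>?n\<close>.\<close>
      moreover have "D * (?n - ?a) ^ (k - 2) + 7 * real k ^ 4 * ?n ^ (k - 2) \<le> D * ?n ^ (k - 2)"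
      proof -
        have "D * (?n - ?a) ^ (k - 2) \<le> D * ((?n - ?a) * ?n ^ (k - 3))"
          unfolding k1(2) power_Suc using D a_le by (intro mult_left_mono power_mono) auto
        moreover have "7 * real k ^ 4 * ?n ^ (k - 2) \<le> D * (?a * ?n ^ (k - 3))"
        proof -
          have "7 * real k ^ 4 * ?n ^ (k - 2) = (14 * real k ^ 4 / c) * (c * ?n / 2 * ?n ^ (k - 3))"
            unfolding pow using c by simp
          also have "\<dots> \<le> D * (?a * ?n ^ (k - 3))"
            using a c by (intro mult_mono mult_right_mono) (auto simp: D_def)
          finally show ?thesis .
        qed
        ultimately show ?thesis unfolding pow by (simp add: algebra_simps)
      qed
      ultimately show ?thesis by linarith
    qed
  qed
  then show ?thesis using that[OF D] unfolding p_def by blast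
qed

subsection \<open>The layered digraph\<close>

text \<open>Vertex \<open>0\<close> is the hub; the others are dealt in turn to the levels
  \<open>1\<close> to \<open>k - 1\<close>, so that their sizes differ by at most one.\<close>

definition level :: "nat \<Rightarrow> nat \<Rightarrow> nat" where
  "level k x = (if x = 0 then 0 else Suc ((x - 1) mod (k - 1)))"

definition layered :: "nat \<Rightarrow> nat \<Rightarrow> nat rel" where
  "layered k n = {(x, y). x < n \<and> y < n \<and> level k y = Suc (level k x) mod k}"

lemma level_less:
  assumes "2 \<le> k"
  shows "level k x < k"
proof -
  have "(x - 1) mod (k - 1) < k - 1" using assms by (intro mod_less_divisor) simp
  then show ?thesis using assms unfolding level_def by (simp only: split: if_split) linarith
qed

text \<open>Levels advance by one modulo \<open>k\<close>, so \<open>k\<close> divides the length; a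
  second round would visit vertex \<open>0\<close>, the only one of level \<open>0\<close>,
  again.\<close>

lemma length_dcycle_layered:
  assumes k: "2 \<le> k" and xs: "dcycle (layered k n) xs"
  shows "length xs = k"
proof -
  let ?l = "length xs" and ?L = "level k (xs ! 0)"
  have path: "xs \<noteq> []" "distinct xs" "successively (\<lambda>x y. (x, y) \<in> layered k n) xs"
      "(last xs, hd xs) \<in> layered k n"
    using xs by (auto simp: dcycle_iff dpath_def)
  have lev: "level k (xs ! i) = (?L + i) mod k" if "i < ?l" for i
    using that
  proof (induction i)
    case 0
    then show ?case using level_less[OF k] by simp
  next
    case (Suc i)
    then have "level k (xs ! Suc i) = Suc (level k (xs ! i)) mod k"
      using successively_nth[OF path(3)] by (simp add: layered_def)
    then show ?case using Suc by (simp add: mod_Suc_eq)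
  qed
  have "?L = Suc (level k (xs ! (?l - 1))) mod k"
    using path(1,4) by (simp add: layered_def last_conv_nth hd_conv_nth)
  also have "\<dots> = Suc (?L + (?l - 1)) mod k"
    using lev[of "?l - 1"] path(1) by (simp add: mod_Suc_eq)
  also have "Suc (?L + (?l - 1)) = ?L + ?l" using path(1) by (cases xs) auto
  finally have "(?L + ?l) mod k = (?L + 0) mod k" using level_less[OF k, of "xs ! 0"] by simp
  then have dvd: "k dvd ?l"
    by (metis add_diff_cancel_left' add_0_right mod_eq_dvd_iff_nat le_add1)
  show ?thesis
  proof (rule ccontr)
    assume "?l \<noteq> k"
    moreover obtain q where q: "?l = k * q" using dvd by blast
    moreover have "q \<noteq> 0" using q path(1) by (cases "q = 0") auto
    ultimately have "2 \<le> q" by (cases "q = 1") auto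
    then have "k * 2 \<le> ?l" unfolding q by simp
    \<comment> \<open>The first position of level \<open>0\<close>; the outer \<open>mod k\<close>
      covers \<open>?L = 0\<close>.\<close>
    define i where "i = (k - ?L) mod k"
    have i: "i < k" using k by (simp add: i_def)
    have z: "(?L + i) mod k = 0" using level_less[OF k, of "xs ! 0"] by (simp add: i_def mod_add_right_eq)
    have "xs ! i = 0" "xs ! (i + k) = 0"
      using lev[of i] lev[of "i + k"] i z \<open>k * 2 \<le> ?l\<close>
      by (auto simp: level_def split: if_splits simp flip: add.assoc)
    then have "i = i + k"
      using path(2) i \<open>k * 2 \<le> ?l\<close> nth_eq_iff_index_eq[of xs i "i + k"] by auto
    then show False using k by simp
  qed
qed

text \<open>Each choice of one among \<open>?m\<close> vertices in every layer gives a cycle. A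
  vertex determines its position through its level, so the vertex set alone determines the
  choice.\<close>

lemma card_cycles_layered:
  assumes k: "2 \<le> k"
  shows "((n - 1) div (k - 1)) ^ (k - 1) \<le> card (cycles (layered k n) k)"
proof -
  let ?m = "(n - 1) div (k - 1)"
  let ?T = "PiE {1..<k} (\<lambda>_. {..<?m})"
  \<comment> \<open>\<open>i + (k - 1) * t i\<close> runs through the vertices of level
    \<open>i\<close>, counted from \<open>t i = 0\<close>.\<close>
  define vs where "vs t = map (\<lambda>i. if i = 0 then 0 else i + (k - 1) * t i) [0..<k]" for t :: "nat \<Rightarrow> nat"
  have lev: "level k (vs t ! i) = i" if "i < k" for t i
  proof (cases i)
    case (Suc j)
    then have "(j + (k - 1) * t i) mod (k - 1) = j" using that by simp
    then show ?thesis using that Suc by (simp add: vs_def level_def)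
  qed (use that in \<open>simp add: vs_def level_def\<close>)
  have bound: "vs t ! i < n" if "t \<in> ?T" "i < k" "0 < ?m" for t i
  proof -
    have n: "(k - 1) * ?m \<le> n - 1" by simp
    have npos: "0 < n" using that(3) by (cases n) auto
    show ?thesis
    proof (cases "i = 0")
      case False
      then have "t i < ?m" using that PiE_mem[OF that(1), of i] by auto
      then have "(k - 1) * Suc (t i) \<le> (k - 1) * ?m" by (intro mult_left_mono) auto
      then have "(k - 1) * t i + (k - 1) \<le> n - 1"
        using n unfolding mult_Suc_right by linarith
      then show ?thesis using False that(2) npos by (simp add: vs_def)
    qed (use npos that in \<open>simp add: vs_def\<close>)
  qed
  have len: "length (vs t) = k" for t by (simp add: vs_def)
  have cyc: "dcycle (layered k n) (vs t)" if "t \<in> ?T" "0 < ?m" for t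
    unfolding dcycle_iff dpath_def
  proof (intro conjI)
    show ne: "vs t \<noteq> []" using len[of t] k by auto
    show "distinct (vs t)" using lev len by (metis distinct_conv_nth)
    show "successively (\<lambda>x y. (x, y) \<in> layered k n) (vs t)"
      using lev len bound[OF that(1) _ that(2)] by (simp add: successively_conv_nth layered_def)
    show "(last (vs t), hd (vs t)) \<in> layered k n"
      using ne lev len bound[OF that(1) _ that(2)] k
      by (simp add: layered_def last_conv_nth hd_conv_nth)
  qed
  show ?thesis
  \<comment> \<open>For \<open>?m = 0\<close> the hub itself may be missing, as \<open>n = 0\<close>
    is possible, but the bound is then \<open>0\<close>.\<close>
  proof (cases "?m = 0")
    case True
    then have "?m ^ (k - 1) = 0" using k by (simp add: power_0_left)
    then show ?thesis by (simp only: le0)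
  next
    case False
    have "card ?T \<le> card (cycles (layered k n) k)"
    proof (rule card_inj_on_le)
      show "(\<lambda>t. arcset (vs t)) ` ?T \<subseteq> cycles (layered k n) k"
        using cyc len False by (auto simp: cycles_def)
      show "finite (cycles (layered k n) k)"
        by (rule finite_cycles[of "{..<n}"]) (auto simp: layered_def)
      show "inj_on (\<lambda>t. arcset (vs t)) ?T"
      proof (rule inj_onI)
        fix t s assume *: "t \<in> ?T" "s \<in> ?T" "arcset (vs t) = arcset (vs s)"
        show "t = s"
        proof (rule PiE_ext[OF *(1,2)])
          fix i assume i: "i \<in> {1..<k}"
          have "set (vs t) = set (vs s)" using *(3) by (metis Domain_arcset)
          then have "vs t ! i \<in> set (vs s)" using i len by (metis atLeastLessThan_iff nth_mem)
          then obtain j where j: "j < k" "vs s ! j = vs t ! i" using len by (metis in_set_conv_nth)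
          then have "j = i" using lev i by (metis atLeastLessThan_iff)
          then show "t i = s i" using j i k by (simp add: vs_def)
        qed
      qed
    qed
    then show ?thesis by (simp add: card_PiE)
  qed
qed

subsection \<open>Cycles in the sense of arc walks\<close>

text \<open>Every head is the next tail, so the heads are the tails shifted by one, followed by the
  end of the walk.\<close>

lemma pcas_iff:
  assumes "p \<noteq> []"
  shows "pcas u p v \<longleftrightarrow> fst (hd p) = u \<and> map snd p = tl (map fst p) @ [v]"
  using assms
proof (induction p arbitrary: u)
  case (Cons e p)
  show ?case
  proof (cases p)
    case (Cons e' p')
    then have "pcas (snd e) p v \<longleftrightarrow> fst e' = snd e \<and> map snd p = map fst p' @ [v]"
      using Cons.IH[of "snd e"] by simp
    then show ?thesis using Cons by auto
  qed simp
qed simp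

lemma pawalk_verts_eq: "pcas u p v \<Longrightarrow> pawalk_verts u p = u # map snd p"
  by (induction p arbitrary: u) auto

text \<open>In a closed walk the heads are the tails rotated by one, so the tails determine the arc
  list, and distinct heads mean distinct tails.\<close>

lemma cycle_iff_dcycle:
  assumes "pair_digraph G"
  shows "pre_digraph.cycle (with_proj G) p \<longleftrightarrow>
    (\<exists>xs. p = zip xs (rotate1 xs) \<and> dcycle (parcs G) xs)"
proof -
  interpret pair_digraph G by fact
  have cycle: "pre_digraph.cycle (with_proj G) p \<longleftrightarrow> p \<noteq> [] \<and> set p \<subseteq> parcs G \<and>
      map snd p = rotate1 (map fst p) \<and> distinct (map fst p)"
  proof (cases "p = []")
    case False
    have "pcas u p u \<and> distinct (tl (pawalk_verts u p)) \<longleftrightarrow> pcas u p u \<and> distinct (map snd p)" for u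
      using pawalk_verts_eq[of u p u] by auto
    then have "pre_digraph.cycle (with_proj G) p \<longleftrightarrow> (\<exists>u. u \<in> pverts G \<and> set p \<subseteq> parcs G \<and>
        pcas u p u \<and> distinct (map snd p))"
      using False unfolding pre_digraph.cycle_def pre_digraph.awalk_def cas_with_proj_eq
          awalk_verts_with_proj_eq with_proj_simps by blast
    also have "\<dots> \<longleftrightarrow> set p \<subseteq> parcs G \<and> pcas (fst (hd p)) p (fst (hd p)) \<and> distinct (map snd p)"
    proof -
      have "fst (hd p) \<in> pverts G" if "set p \<subseteq> parcs G"
        using that hd_in_set[OF False] by (intro arc_fst_in_verts) blast
      then show ?thesis using pcas_iff[OF False] by metis
    qed
    also have "\<dots> \<longleftrightarrow> set p \<subseteq> parcs G \<and> map snd p = rotate1 (map fst p) \<and> distinct (map fst p)"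
    proof -
      have "rotate1 (map fst p) = tl (map fst p) @ [fst (hd p)]"
        using False by (simp add: rotate1_hd_tl hd_map)
      then have "pcas (fst (hd p)) p (fst (hd p)) \<longleftrightarrow> map snd p = rotate1 (map fst p)"
        using pcas_iff[OF False] by simp
      moreover have "distinct (map snd p) \<longleftrightarrow> distinct (map fst p)"
        if "map snd p = rotate1 (map fst p)"
        unfolding that by (rule distinct1_rotate)
      ultimately show ?thesis by blast
    qed
    finally show ?thesis using False by simp
  qed (simp add: pre_digraph.cycle_def)
  show ?thesis
  proof
    assume "pre_digraph.cycle (with_proj G) p"
    then have p: "p \<noteq> []" "set p \<subseteq> parcs G" "map snd p = rotate1 (map fst p)" "distinct (map fst p)"
      using cycle by auto
    then have "p = zip (map fst p) (rotate1 (map fst p))" by (metis zip_map_fst_snd)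
    then show "\<exists>xs. p = zip xs (rotate1 xs) \<and> dcycle (parcs G) xs"
      using p by (metis arcset_def dcycle_def list.map_disc_iff)
  next
    assume "\<exists>xs. p = zip xs (rotate1 xs) \<and> dcycle (parcs G) xs"
    then obtain xs where xs: "p = zip xs (rotate1 xs)" "dcycle (parcs G) xs" by blast
    have "map fst p = xs" "map snd p = rotate1 xs" using xs(1) by simp_all
    moreover have "p \<noteq> []" using \<open>map fst p = xs\<close> xs(2) by (auto simp: dcycle_def)
    ultimately show "pre_digraph.cycle (with_proj G) p"
      unfolding cycle using xs by (simp add: dcycle_def arcset_def)
  qed
qed

section \<open>Bounds for \<open>max_cycles\<close>\<close>

lemma directed_cycles_eq:
  assumes "pair_digraph G"
  shows "directed_cycles G = arcset ` {xs. dcycle (parcs G) xs}"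
  unfolding directed_cycles_def arcset_def using cycle_iff_dcycle[OF assms] by auto

lemma L_cycle_digraph_iff:
  "L_cycle_digraph L G \<longleftrightarrow> pair_digraph G \<and> (\<forall>xs. dcycle (parcs G) xs \<longrightarrow> length xs \<in> L)"
  unfolding L_cycle_digraph_def using cycle_iff_dcycle by fastforce

lemma bounded_circumference_L_cycle:
  assumes "L_cycle_digraph L G" "finite L" "k = Max L"
  shows "bounded_circumference (pverts G) (parcs G) k"
proof -
  interpret pair_digraph G using assms(1) by (simp add: L_cycle_digraph_def)
  show ?thesis
  proof
    show "finite (pverts G)" by (rule pair_finite_verts)
    show "parcs G \<subseteq> pverts G \<times> pverts G" by (auto dest: in_arcsD1 in_arcsD2)
    show "length xs \<le> k" if "dcycle (parcs G) xs" for xs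
      using that assms by (auto simp: L_cycle_digraph_iff)
  qed
qed

text \<open>By \<open>card_cycles_le\<close>, each of the fewer than \<open>k\<close> lengths below
  \<open>k\<close> contributes at most order \<open>n ^ (k - 2)\<close>.\<close>

lemma card_directed_cycles_le:
  assumes G: "L_cycle_digraph L G" and L: "finite L" "\<forall>l\<in>L. 2 \<le> l" "k = Max L"
  shows "card (directed_cycles G) \<le> card (cycles (parcs G) k) + (k * k) * card (pverts G) ^ (k - 2)"
proof -
  let ?E = "parcs G" and ?V = "pverts G"
  interpret bounded_circumference ?V ?E k by (rule bounded_circumference_L_cycle[OF G L(1,3)])
  have "directed_cycles G \<subseteq> cycles ?E k \<union> (\<Union>l\<in>{2..<k}. cycles ?E l)"
  proof
    fix c assume "c \<in> directed_cycles G"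
    then obtain xs where xs: "dcycle ?E xs" "c = arcset xs"
      using G by (auto simp: directed_cycles_eq L_cycle_digraph_def)
    then have "length xs \<in> L" using G by (simp add: L_cycle_digraph_iff)
    then have "2 \<le> length xs" "length xs \<le> k" using L by auto
    moreover have "c \<in> cycles ?E (length xs)" using xs by (auto simp: cycles_def)
    ultimately show "c \<in> cycles ?E k \<union> (\<Union>l\<in>{2..<k}. cycles ?E l)"
      by (cases "length xs = k") auto
  qed
  then have "card (directed_cycles G) \<le> card (cycles ?E k \<union> (\<Union>l\<in>{2..<k}. cycles ?E l))"
    by (rule card_mono[rotated]) (use finite_cycles[OF finV EV] in blast)
  also have "\<dots> \<le> card (cycles ?E k) + card (\<Union>l\<in>{2..<k}. cycles ?E l)" by (rule card_Un_le)
  also have "card (\<Union>l\<in>{2..<k}. cycles ?E l) \<le> card {2..<k} * (k * card ?V ^ (k - 2))"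
  proof (rule card_UN_bound)
    fix l assume l: "l \<in> {2..<k}"
    show "card (cycles ?E l) \<le> k * card ?V ^ (k - 2)"
    \<comment> \<open>Raising the exponent from \<open>l - 1\<close> to \<open>k - 2\<close> needs a
      base of at least 1.\<close>
    proof (cases "card ?V = 0")
      case True
      then have "card (cycles ?E l) \<le> 0"
        using card_cycles_trivial[OF finV EV, of l] l by (simp add: power_0_left)
      then show ?thesis by linarith
    next
      case False
      have "card (cycles ?E l) \<le> (k - 1) * card ?V ^ (l - 1)"
        using l by (intro card_cycles_le bounded_circumference_axioms) auto
      also have "\<dots> \<le> k * card ?V ^ (k - 2)"
        using l False by (intro mult_mono power_increasing) auto
      finally show ?thesis .
    qed
  qed simp
  also have "\<dots> \<le> k * (k * card ?V ^ (k - 2))" by (intro mult_right_mono) auto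
  finally show ?thesis by (simp add: mult_ac)
qed

lemma max_cycles_upper:
  fixes L :: "nat set"
  assumes L: "finite L" "L \<noteq> {}" "\<forall>l\<in>L. 2 \<le> l" "k = Max L"
  obtains C :: real where "0 \<le> C"
    "\<And>n. real (max_cycles L n) \<le> (real n / (real k - 1)) ^ (k - 1) + C * real n ^ (k - 2)"
proof -
  have k: "2 \<le> k" using L by simp
  obtain D :: real where D: "0 \<le> D"
    "\<And>(V :: nat set) E. bounded_circumference V E k \<Longrightarrow>
       real (card (cycles E k)) \<le> (real (card V) / (real k - 1)) ^ (k - 1) + D * real (card V) ^ (k - 2)"
  \<comment> \<open>The hub argument requires \<open>k\<close> to be at least 3; for
    \<open>k = 2\<close> the bound of \<open>card_cycles_le\<close> is already the leading term,
    with \<open>D = 0\<close>.\<close>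
  proof (cases "k = 2")
    case True
    have "real (card (cycles E k)) \<le> (real (card V) / (real k - 1)) ^ (k - 1) + 0 * real (card V) ^ (k - 2)"
      if "bounded_circumference V E k" for V :: "nat set" and E
      using card_cycles_le[OF that, of 2] True by simp
    then show ?thesis using that[of 0] by blast
  next
    case False
    then show ?thesis using k that card_cycles_upper[of k] by (metis One_nat_def Suc_1
      nle_le not_less_eq_eq numeral_3_eq_3)
  qed
  let ?C = "D + real k * real k"
  have "real (max_cycles L n) \<le> (real n / (real k - 1)) ^ (k - 1) + ?C * real n ^ (k - 2)" for n
  proof -
    have "max_cycles L n \<in> {card (directed_cycles G) |G :: nat pair_pre_digraph.
            L_cycle_digraph L G \<and> card (pverts G) = n}"
      unfolding max_cycles_def by (rule Max_in[OF finite_cycle_counts cycle_counts_nonempty])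
    then obtain G :: "nat pair_pre_digraph"
      where G: "L_cycle_digraph L G" "card (pverts G) = n" "max_cycles L n = card (directed_cycles G)"
      by auto
    have "real (max_cycles L n) \<le> real (card (cycles (parcs G) k) + (k * k) * n ^ (k - 2))"
      using card_directed_cycles_le[OF G(1) L(1,3,4)] unfolding G(2,3) by (simp only: of_nat_le_iff)
    also have "\<dots> = real (card (cycles (parcs G) k)) + real k * real k * real n ^ (k - 2)" by simp
    finally show ?thesis
      using D(2)[OF bounded_circumference_L_cycle[OF G(1) L(1,4)]] unfolding G(2)
      by (simp add: distrib_right)
  qed
  then show ?thesis using that[of ?C] D(1) by simp
qed

lemma max_cycles_lower:
  fixes L :: "nat set"
  assumes L: "k \<in> L" and k: "2 \<le> k"
  shows "((n - 1) div (k - 1)) ^ (k - 1) \<le> max_cycles L n"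
proof -
  let ?G = "\<lparr>pverts = {..<n}, parcs = layered k n\<rparr>"
  have G: "pair_digraph ?G"
  proof
    show "finite (parcs ?G)"
      by (rule finite_subset[of _ "{..<n} \<times> {..<n}"]) (auto simp: layered_def)
    show "fst e \<noteq> snd e" if "e \<in> parcs ?G" for e
    proof
      assume "fst e = snd e"
      then have "level k (fst e) = Suc (level k (fst e)) mod k"
        using that by (auto simp: layered_def)
      then show False using level_less[OF k, of "fst e"] k by (auto simp: mod_Suc split: if_splits)
    qed
  qed (auto simp: layered_def)
  have "L_cycle_digraph L ?G"
    using G length_dcycle_layered[OF k] L by (simp add: L_cycle_digraph_iff)
  then have "card (directed_cycles ?G) \<le> max_cycles L n"
    unfolding max_cycles_def by (intro Max_ge[OF finite_cycle_counts]) force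
  moreover have "cycles (layered k n) k = directed_cycles ?G"
    using length_dcycle_layered[OF k, of n] by (auto simp: directed_cycles_eq[OF G] cycles_def)
  ultimately show ?thesis using card_cycles_layered[OF k, of n] by (simp only: order_trans)
qed

theorem theorem4:
  fixes L :: "nat set" and k :: nat
  assumes "finite L" and "L \<noteq> {}" and "\<forall>l\<in>L. 2 \<le> l" and "k = Max L"
  shows "(\<lambda>n. real (max_cycles L n) - ((real n - 1) / (real k - 1)) ^ (k - 1))
           \<in> O(\<lambda>n. real n ^ (k - 2))"
proof -
  have kL: "k \<in> L" using assms by simp
  then have k: "2 \<le> k" using assms(3) by simp
  have k1: "k - 1 = Suc (k - 2)" using k by simp
  define p where "p = real k - 1"
  have p: "1 \<le> p" "real (k - 1) = p" using k by (simp_all add: p_def of_nat_diff)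
  obtain C :: real where C: "0 \<le> C"
    "\<And>n. real (max_cycles L n) \<le> (real n / p) ^ (k - 1) + C * real n ^ (k - 2)"
    unfolding p_def by (rule max_cycles_upper[OF assms]) blast
  have "\<bar>real (max_cycles L n) - ((real n - 1) / p) ^ (k - 1)\<bar> \<le> (C + p) * real n ^ (k - 2)"
    if n: "1 \<le> n" for n
  proof -
    let ?x = "(real n - 1) / p"
    let ?m = "(n - 1) div (k - 1)"
    have np: "real n / p \<le> real n"
      using mult_left_mono[OF p(1), of "real n"] p(1) by (simp add: divide_le_eq)
    have "?x \<le> real n / p" using p(1) by (simp add: divide_right_mono)
    then have x: "0 \<le> ?x" "?x \<le> real n" "real n / p \<le> real n"
      using np n p(1) by simp_all
    \<comment> \<open>The upper bound has \<open>n\<close> where the claim has \<open>n - 1\<close>;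
      the bases differ by \<open>1 / p\<close>, which cancels the factor \<open>p\<close>.\<close>
    have "(real n / p) ^ (k - 1) - ?x ^ (k - 1) \<le> p * (real n / p - ?x) * (real n / p) ^ (k - 2)"
      using power_diff_le[of ?x "real n / p" "k - 2"] x p unfolding k1[symmetric] p(2)
      by (simp add: divide_right_mono)
    also have "p * (real n / p - ?x) = 1" using p by (simp add: field_simps)
    also have "1 * (real n / p) ^ (k - 2) \<le> p * real n ^ (k - 2)"
      using x p by (intro mult_mono power_mono) auto
    finally have "real (max_cycles L n) - ?x ^ (k - 1) \<le> (C + p) * real n ^ (k - 2)"
      using C(2)[of n] by (simp add: distrib_right)
    moreover have "?x ^ (k - 1) - real (max_cycles L n) \<le> (C + p) * real n ^ (k - 2)"
    proof -
      \<comment> \<open>Rounding the layer size down to an integer changes the base by at most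
        1.\<close>
      have m: "real ?m \<le> ?x" "?x - real ?m \<le> 1"
      proof -
        have eq: "real (n - 1) / real (k - 1) = ?x" using n p(2) by (simp add: of_nat_diff)
        then show "real ?m \<le> ?x"
          using of_nat_div_le_of_nat[of "n - 1" "k - 1", where 'a = real] by simp
        have "n - 1 < (k - 1) + (k - 1) * ?m" using k by (intro dividend_less_times_div) simp
        then have "real (n - 1) \<le> real ((k - 1) + (k - 1) * ?m)" unfolding of_nat_le_iff by (rule less_imp_le)
        then have "real (n - 1) \<le> (1 + real ?m) * real (k - 1)"
          by (simp only: of_nat_add of_nat_mult distrib_right mult_1 mult.commute[of "real ?m"])
        then have "real (n - 1) / real (k - 1) \<le> 1 + real ?m"
          using p by (simp only: pos_divide_le_eq)
        then show "?x - real ?m \<le> 1" unfolding eq by simp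
      qed
      have "?x ^ (k - 1) - real ?m ^ (k - 1) \<le> p * (?x - real ?m) * ?x ^ (k - 2)"
        using power_diff_le[of "real ?m" ?x "k - 2"] m unfolding k1[symmetric] p(2) by simp
      also have "\<dots> \<le> p * 1 * real n ^ (k - 2)"
        using m x p by (intro mult_mono power_mono mult_left_mono) auto
      finally have "?x ^ (k - 1) - real ?m ^ (k - 1) \<le> p * real n ^ (k - 2)" by simp
      moreover have "real ?m ^ (k - 1) \<le> real (max_cycles L n)"
        using max_cycles_lower[OF kL k, of n] by (metis of_nat_le_iff of_nat_power)
      moreover have "0 \<le> C * real n ^ (k - 2)" using C(1) by simp
      ultimately show ?thesis unfolding distrib_right by linarith
    qed
    ultimately show ?thesis by linarith
  qed
  then have "eventually (\<lambda>n. norm (real (max_cycles L n) - ((real n - 1) / p) ^ (k - 1))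
      \<le> (C + p) * norm (real n ^ (k - 2))) at_top"
    by (intro eventually_mono[OF eventually_ge_at_top[of 1]]) simp
  then show ?thesis unfolding p_def by (rule bigoI)
qed

end
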